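(* Let $\Delta=\{z\in\mathbb{C}:|z|<1\}$. There exists a Beltrami differential $\mu\in Bel(\Delta)$ such that $\mu$ is the unique non-decreasable extremal dilatation in $[\mu]_Z$, while $[\mu]_Z$ contains infinitely many pseudo non-decreasable extremal dilatations.
   Context: $Bel(\Delta)$ is the Banach space of Beltrami differentials $\mu=\mu(z)\,d\bar z/dz$ on $\Delta$ with finite $L^\infty$-norm (i.e. complex-valued $\mu\in L^\infty(\Delta)$; elements are identified when equal a.e.). The norm is not required to be less than $1$. $Q(\Delta)$ is the Banach space of holomorphic functions (quadratic differentials) $\varphi$ on $\Delta$ with $\|\varphi\|=\iint_\Delta|\varphi(z)|\,dxdy<\infty$. Two elements $\mu,\nu\in Bel(\Delta)$ are infinitesimally Teichmüller equivalent if $\iint_\Delta(\mu-\nu)\varphi\,dxdy=0$ for all $\varphi\in Q(\Delta)$; $[\mu]_Z$ denotes the equivalence class of $\mu$, with norm $\|[\mu]_Z\|=\inf\{\|\nu\|_\infty:\nu\in[\mu]_Z\}$. A Beltrami differential (also called a dilatation) $\nu\in[\mu]_Z$ is extremal if $\|\nu\|_\infty=\|[\mu]_Z\|$. A Beltrami differential $\mu$ is non-decreasable in $[\mu]_Z$ if, for $\nu\in[\mu]_Z$, $|\nu(z)|\le|\mu(z)|$ a.e. in $\Delta$ implies $\nu=\mu$ (a.e.); otherwise it is decreasable. $\mu$ is strongly decreasable in $[\mu]_Z$ if there exists $\nu\in[\mu]_Z$ such that (A) $|\nu(z)|\le|\mu(z)|$ for almost all $z\in\Delta$, and (B) there exist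 a (nonempty) domain $G\subset\Delta$ and $\delta>0$ with $|\nu(z)|\le|\mu(z)|-\delta$ for almost all $z\in G$. Otherwise $\mu$ is weakly non-decreasable. $\mu$ is pseudo non-decreasable if it is weakly non-decreasable but not non-decreasable. *)

theory Defs
  imports "HOL-Analysis.Analysis" "HOL-Probability.Essential_Supremum"
begin

abbreviation unit_disc :: "complex set" ("\<Delta>") where
  "\<Delta> \<equiv> ball 0 1"

(* Elements of Bel are functions on the whole plane, of which only the restriction to the disc
   matters, and that only up to the a.e. equality bel_eq below. No bound by 1 is imposed. *)
definition bel_norm :: "(complex \<Rightarrow> complex) \<Rightarrow> real" where
  "bel_norm \<mu> = real_of_ereal (esssup (lebesgue_on \<Delta>) (\<lambda>z. ereal (cmod (\<mu> z))))"

definition Bel :: "(complex \<Rightarrow> complex) set" where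
  "Bel = {\<mu>. \<mu> \<in> borel_measurable (lebesgue_on \<Delta>) \<and>
             esssup (lebesgue_on \<Delta>) (\<lambda>z. ereal (cmod (\<mu> z))) < \<infinity>}"

definition bel_eq :: "((complex \<Rightarrow> complex) \<times> (complex \<Rightarrow> complex)) set" where
  "bel_eq = {(\<mu>, \<nu>). \<mu> \<in> Bel \<and> \<nu> \<in> Bel \<and> (AE z in lebesgue_on \<Delta>. \<mu> z = \<nu> z)}"

definition QD :: "(complex \<Rightarrow> complex) set" where
  "QD = {\<phi>. \<phi> holomorphic_on \<Delta> \<and> integrable (lebesgue_on \<Delta>) \<phi>}"

definition inf_teich_equiv :: "(complex \<Rightarrow> complex) \<Rightarrow> (complex \<Rightarrow> complex) \<Rightarrow> bool" where
  "inf_teich_equiv \<mu> \<nu> \<longleftrightarrow> (\<forall>\<phi>\<in>QD. (LINT z|lebesgue_on \<Delta>. (\<mu> z - \<nu> z) * \<phi> z) = 0)"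

definition Zclass :: "(complex \<Rightarrow> complex) \<Rightarrow> (complex \<Rightarrow> complex) set" where
  "Zclass \<mu> = {\<nu> \<in> Bel. inf_teich_equiv \<mu> \<nu>}"

(* In the following predicates C is meant to be a class Zclass \<mu>. *)
definition class_norm :: "(complex \<Rightarrow> complex) set \<Rightarrow> real" where
  "class_norm C = (INF \<nu>\<in>C. bel_norm \<nu>)"

definition extremal_in :: "(complex \<Rightarrow> complex) set \<Rightarrow> (complex \<Rightarrow> complex) \<Rightarrow> bool" where
  "extremal_in C \<nu> \<longleftrightarrow> \<nu> \<in> C \<and> bel_norm \<nu> = class_norm C"

definition non_decreasable_in :: "(complex \<Rightarrow> complex) set \<Rightarrow> (complex \<Rightarrow> complex) \<Rightarrow> bool" where
  "non_decreasable_in C \<mu> \<longleftrightarrow> \<mu> \<in> C \<and>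
     (\<forall>\<nu>\<in>C. (AE z in lebesgue_on \<Delta>. cmod (\<nu> z) \<le> cmod (\<mu> z)) \<longrightarrow> (\<nu>, \<mu>) \<in> bel_eq)"

definition strongly_decreasable_in :: "(complex \<Rightarrow> complex) set \<Rightarrow> (complex \<Rightarrow> complex) \<Rightarrow> bool" where
  "strongly_decreasable_in C \<mu> \<longleftrightarrow> \<mu> \<in> C \<and>
     (\<exists>\<nu>\<in>C. (AE z in lebesgue_on \<Delta>. cmod (\<nu> z) \<le> cmod (\<mu> z)) \<and>
        (\<exists>G \<delta>. open G \<and> connected G \<and> G \<noteq> {} \<and> G \<subseteq> \<Delta> \<and> \<delta> > 0 \<and>
           (AE z in lebesgue_on G. cmod (\<nu> z) \<le> cmod (\<mu> z) - \<delta>)))"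

definition weakly_non_decreasable_in :: "(complex \<Rightarrow> complex) set \<Rightarrow> (complex \<Rightarrow> complex) \<Rightarrow> bool" where
  "weakly_non_decreasable_in C \<mu> \<longleftrightarrow> \<mu> \<in> C \<and> \<not> strongly_decreasable_in C \<mu>"

definition pseudo_non_decreasable_in :: "(complex \<Rightarrow> complex) set \<Rightarrow> (complex \<Rightarrow> complex) \<Rightarrow> bool" where
  "pseudo_non_decreasable_in C \<mu> \<longleftrightarrow> weakly_non_decreasable_in C \<mu> \<and> \<not> non_decreasable_in C \<mu>"

end

theory Submission
  imports Defs "HOL-Complex_Analysis.Cauchy_Integral_Formula"
begin

text \<open>
  Let \<open>E\<close> be the part of the disc inside the circle \<open>\<bar>z + 1\<bar> = 3/2\<close> and \<open>A\<close> the part outside.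
  By pole pushing there are bounded holomorphic \<open>g\<close> that are nearly \<open>0\<close> on \<open>A\<close> away from a thin
  collar of the circle and have very negative real part on \<open>E\<close>. Adding up such \<open>g\<close>, with collars
  shrinking so fast that earlier sums do not notice them, yields \<open>\<phi>\<^sub>n = exp G\<^sub>n\<close> that tend
  uniformly to \<open>0\<close> on \<open>E\<close> and pointwise to some \<open>\<Phi> \<noteq> 0\<close> on \<open>A\<close>, such that
  \<open>\<mu> = cnj (sgn \<Phi>)\<close> on \<open>A\<close>, \<open>\<mu> = 0\<close> on \<open>E\<close> satisfies \<open>\<integral> \<bar>\<phi>\<^sub>n\<bar> - Re (\<mu> \<phi>\<^sub>n) \<longlonglongrightarrow> 0\<close>.
  By Fatou's lemma every member of the class of norm at most \<open>1\<close> then agrees with \<open>\<mu>\<close> on \<open>A\<close>, so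
  \<open>\<mu>\<close> is the smallest extremal and hence the only non-decreasable one.

  Since \<open>E\<close> contains a disc about \<open>0\<close>, it contains a closed rotation invariant set \<open>S\<close> of positive
  area without interior. By rotation invariance \<open>t z 1\<^sub>S\<close> is orthogonal to all holomorphic functions,
  so \<open>\<mu> + t z 1\<^sub>S\<close> is extremal in the same class. It is larger than \<open>\<mu>\<close>, but not strongly
  decreasable: every domain meets the complement of \<open>S\<close> in an open set, where \<open>\<mu> + t z 1\<^sub>S\<close> equals
  \<open>\<mu>\<close>.
\<close>

section \<open>Rotation invariance of planar Lebesgue measure\<close>

lemma Complex_measurable [measurable (raw)]:
  assumes [measurable]: "f \<in> borel_measurable M" "g \<in> borel_measurable M"
  shows "(\<lambda>x. Complex (f x) (g x)) \<in> borel_measurable M"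
  unfolding Complex_eq by measurable

text \<open>Both measures agree on boxes. Identifying the plane with a product makes Tonelli
  available in either order of the coordinates.\<close>

lemma lborel_complex_eq_distr:
  "(lborel :: complex measure) = distr (lborel \<Otimes>\<^sub>M lborel) borel (\<lambda>(x, y). Complex x y)"
proof (rule lborel_eqI)
  have [measurable]: "(\<lambda>(x, y). Complex x y) \<in> borel_measurable (lborel \<Otimes>\<^sub>M lborel)"
    unfolding Complex_eq case_prod_beta by measurable
  fix l u :: complex
  assume le: "\<And>b. b \<in> Basis \<Longrightarrow> l \<bullet> b \<le> u \<bullet> b"
  have le': "Re l \<le> Re u" "Im l \<le> Im u"
    using le[of 1] le[of \<i>] by (auto simp: inner_complex_def)
  have "(\<lambda>(x, y). Complex x y) -` box l u \<inter> space (lborel \<Otimes>\<^sub>M lborel)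
      = {Re l<..<Re u} \<times> {Im l<..<Im u}"
    by (auto simp: box_def Basis_complex_def inner_complex_def space_pair_measure)
  then show "emeasure (distr (lborel \<Otimes>\<^sub>M lborel) borel (\<lambda>(x, y). Complex x y)) (box l u)
      = ennreal (\<Prod>b\<in>Basis. (u - l) \<bullet> b)"
    using le' by (simp add: emeasure_distr lborel.emeasure_pair_measure_Times
        Basis_complex_def inner_complex_def ennreal_mult)
qed simp

lemma nn_integral_lborel_complex:
  assumes [measurable]: "f \<in> borel_measurable borel"
  shows "(\<integral>\<^sup>+z. f z \<partial>lborel) = (\<integral>\<^sup>+y. \<integral>\<^sup>+x. f (Complex x y) \<partial>lborel \<partial>lborel)"
    and "(\<integral>\<^sup>+z. f z \<partial>lborel) = (\<integral>\<^sup>+x. \<integral>\<^sup>+y. f (Complex x y) \<partial>lborel \<partial>lborel)"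
proof -
  have [measurable]: "(\<lambda>(x, y). Complex x y) \<in> borel_measurable (lborel \<Otimes>\<^sub>M lborel)"
    unfolding Complex_eq case_prod_beta by measurable
  have m: "(\<lambda>(x, y). f (Complex x y)) \<in> borel_measurable (lborel \<Otimes>\<^sub>M lborel)"
    using measurable_compose[OF \<open>(\<lambda>(x, y). Complex x y) \<in> _\<close> assms]
    by (simp add: case_prod_beta)
  have eq: "(\<integral>\<^sup>+z. f z \<partial>lborel) = (\<integral>\<^sup>+p. (\<lambda>(x, y). f (Complex x y)) p \<partial>(lborel \<Otimes>\<^sub>M lborel))"
    by (subst lborel_complex_eq_distr, subst nn_integral_distr) (auto simp: case_prod_beta')
  show "(\<integral>\<^sup>+z. f z \<partial>lborel) = (\<integral>\<^sup>+y. \<integral>\<^sup>+x. f (Complex x y) \<partial>lborel \<partial>lborel)"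
    unfolding eq by (subst lborel_pair.nn_integral_snd[OF m, symmetric]) simp
  show "(\<integral>\<^sup>+z. f z \<partial>lborel) = (\<integral>\<^sup>+x. \<integral>\<^sup>+y. f (Complex x y) \<partial>lborel \<partial>lborel)"
    unfolding eq by (subst lborel.nn_integral_fst[OF m, symmetric]) simp
qed

text \<open>With the other coordinate frozen, a shear is a translation of a line. Each part
  therefore integrates first along the moving coordinate and uses translation invariance
  there.\<close>

lemma distr_lborel_shear:
  "distr lborel borel (\<lambda>z. Complex (Re z + a * Im z) (Im z)) = lborel"
  "distr lborel borel (\<lambda>z. Complex (Re z) (Im z + a * Re z)) = lborel"
proof -
  show "distr lborel borel (\<lambda>z. Complex (Re z + a * Im z) (Im z)) = lborel"
  proof (rule measure_eqI)
    fix A assume "A \<in> sets (distr lborel borel (\<lambda>z. Complex (Re z + a * Im z) (Im z)))"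
    then have [measurable]: "A \<in> sets borel" by simp
    have "emeasure (distr lborel borel (\<lambda>z. Complex (Re z + a * Im z) (Im z))) A
        = (\<integral>\<^sup>+z. indicator A z \<partial>distr lborel borel (\<lambda>z. Complex (Re z + a * Im z) (Im z)))"
      by simp
    also have "\<dots> = (\<integral>\<^sup>+z. indicator A (Complex (Re z + a * Im z) (Im z)) \<partial>lborel)"
      by (rule nn_integral_distr) measurable
    \<comment> \<open>The redundant factor \<open>1 * x\<close> gives the inner integrand the shape
      of \<open>nn_integral_real_affine\<close>.\<close>
    also have "\<dots> = (\<integral>\<^sup>+y. \<integral>\<^sup>+x. indicator A (Complex (a * y + 1 * x) y) \<partial>lborel \<partial>lborel)"
      by (subst nn_integral_lborel_complex(1)) (simp_all add: add.commute)
    also have "\<dots> = (\<integral>\<^sup>+y. \<integral>\<^sup>+x. indicator A (Complex x y) \<partial>lborel \<partial>lborel)"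
    proof (rule nn_integral_cong)
      show "(\<integral>\<^sup>+x. indicator A (Complex (a * y + 1 * x) y) \<partial>lborel)
          = (\<integral>\<^sup>+x. indicator A (Complex x y) \<partial>lborel)" for y
        using nn_integral_real_affine[of "\<lambda>x. indicator A (Complex x y)" 1 "a * y"] by simp
    qed
    also have "\<dots> = (\<integral>\<^sup>+z. indicator A z \<partial>lborel)"
      by (subst nn_integral_lborel_complex(1)) simp_all
    finally show "emeasure (distr lborel borel (\<lambda>z. Complex (Re z + a * Im z) (Im z))) A = emeasure lborel A"
      by simp
  qed simp
  show "distr lborel borel (\<lambda>z. Complex (Re z) (Im z + a * Re z)) = lborel"
  proof (rule measure_eqI)
    fix A assume "A \<in> sets (distr lborel borel (\<lambda>z. Complex (Re z) (Im z + a * Re z)))"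
    then have [measurable]: "A \<in> sets borel" by simp
    have "emeasure (distr lborel borel (\<lambda>z. Complex (Re z) (Im z + a * Re z))) A
        = (\<integral>\<^sup>+z. indicator A z \<partial>distr lborel borel (\<lambda>z. Complex (Re z) (Im z + a * Re z)))"
      by simp
    also have "\<dots> = (\<integral>\<^sup>+z. indicator A (Complex (Re z) (Im z + a * Re z)) \<partial>lborel)"
      by (rule nn_integral_distr) measurable
    also have "\<dots> = (\<integral>\<^sup>+x. \<integral>\<^sup>+y. indicator A (Complex x (a * x + 1 * y)) \<partial>lborel \<partial>lborel)"
      by (subst nn_integral_lborel_complex(2)) (simp_all add: add.commute)
    also have "\<dots> = (\<integral>\<^sup>+x. \<integral>\<^sup>+y. indicator A (Complex x y) \<partial>lborel \<partial>lborel)"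
    proof (rule nn_integral_cong)
      show "(\<integral>\<^sup>+y. indicator A (Complex x (a * x + 1 * y)) \<partial>lborel)
          = (\<integral>\<^sup>+y. indicator A (Complex x y) \<partial>lborel)" for x
        using nn_integral_real_affine[of "\<lambda>y. indicator A (Complex x y)" 1 "a * x"] by simp
    qed
    also have "\<dots> = (\<integral>\<^sup>+z. indicator A z \<partial>lborel)"
      by (subst nn_integral_lborel_complex(2)) simp_all
    finally show "emeasure (distr lborel borel (\<lambda>z. Complex (Re z) (Im z + a * Re z))) A = emeasure lborel A"
      by simp
  qed simp
qed

text \<open>A rotation is a product of three shears.\<close>
lemma distr_lborel_rotation:
  assumes "cos (t / 2) \<noteq> 0"
  shows "distr lborel borel (\<lambda>z. cis t * z) = lborel"
proof -
  \<comment> \<open>The value of \<open>a\<close> is forced by \<open>1 + a * sin t = cos t\<close>,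
    the diagonal entry of the product of the three shears; the tangent is why
    \<open>cos (t / 2)\<close> must not vanish.\<close>
  define a where "a = - tan (t / 2)"
  define S where "S = (\<lambda>z. Complex (Re z + a * Im z) (Im z))"
  define T where "T = (\<lambda>z. Complex (Re z) (Im z + sin t * Re z))"
  have [measurable]: "S \<in> borel_measurable borel" "T \<in> borel_measurable borel"
    unfolding S_def T_def by measurable
  have sin: "sin t = 2 * sin (t / 2) * cos (t / 2)" and cos: "cos t = 1 - 2 * (sin (t / 2))\<^sup>2"
    using sin_double[of "t / 2"] cos_double_sin[of "t / 2"] by simp_all
  have ab: "1 + a * sin t = cos t"
    using assms by (simp add: a_def tan_def sin cos power2_eq_square)
  have aa: "a + a * cos t = - sin t"
  proof -
    have "a + a * cos t = 2 * a * (cos (t/2))\<^sup>2"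
      by (simp add: cos cos_squared_eq algebra_simps)
    then show ?thesis using assms by (simp add: a_def tan_def sin power2_eq_square)
  qed
  have "S (T (S z)) = cis t * z" for z
  proof -
    have "Re (S (T (S z))) = (1 + a * sin t) * Re z + (a + a * (1 + a * sin t)) * Im z"
      by (simp add: S_def T_def algebra_simps)
    moreover have "Im (S (T (S z))) = sin t * Re z + (1 + a * sin t) * Im z"
      by (simp add: S_def T_def algebra_simps)
    ultimately show ?thesis unfolding ab aa by (simp add: complex_eq_iff)
  qed
  then have "(\<lambda>z. cis t * z) = S \<circ> (T \<circ> S)" by auto
  moreover have "distr lborel borel (S \<circ> (T \<circ> S)) = distr (distr (distr lborel borel S) borel T) borel S"
    by (simp add: distr_distr comp_assoc)
  moreover have "distr lborel borel S = lborel" "distr lborel borel T = lborel"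
    unfolding S_def T_def by (rule distr_lborel_shear)+
  ultimately show ?thesis by metis
qed

section \<open>Rotation invariant sets and holomorphic functions\<close>

text \<open>A rotation by \<open>t\<close> preserves the integral but also multiplies it by
  \<open>cis t ^ Suc n\<close>. Any angle for which this factor differs from 1 forces the value
  0.\<close>

lemma integral_rotation_invariant_power:
  assumes S: "S \<in> sets borel" and rot: "\<And>z w. cmod z = cmod w \<Longrightarrow> z \<in> S \<Longrightarrow> w \<in> S"
  shows "(LINT z|lborel. indicator S z * z ^ Suc n) = (0 :: complex)"
proof -
  \<comment> \<open>This angle makes the factor equal to \<open>\<i>\<close> and stays below
    \<open>pi\<close>, so that \<open>distr_lborel_rotation\<close> applies.\<close>
  define t where "t = pi / (2 * real (Suc n))"
  define I where "I = (LINT z|lborel. indicator S z * z ^ Suc n :: complex)"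
  have [measurable]: "S \<in> sets borel" by fact
  have t: "t > 0" "t < pi"
    using pi_gt_zero by (auto simp: t_def field_simps intro!: add_pos_nonneg)
  then have "cos (t / 2) \<noteq> 0" using cos_gt_zero[of "t / 2"] by simp
  then have "I = (LINT z|distr lborel borel (\<lambda>z. cis t * z). indicator S z * z ^ Suc n)"
    unfolding I_def by (simp add: distr_lborel_rotation)
  also have "\<dots> = (LINT z|lborel. indicator S (cis t * z) * (cis t * z) ^ Suc n)"
    by (rule integral_distr) measurable
  also have "\<dots> = (LINT z|lborel. cis t ^ Suc n * (indicator S z * z ^ Suc n))"
  proof (rule Bochner_Integration.integral_cong)
    fix z :: complex
    have "cis t * z \<in> S \<longleftrightarrow> z \<in> S"
      using rot[of "cis t * z" z] rot[of z "cis t * z"] by (auto simp: norm_mult)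
    then show "indicator S (cis t * z) * (cis t * z) ^ Suc n
        = cis t ^ Suc n * (indicator S z * z ^ Suc n :: complex)"
      by (auto simp: indicator_def power_mult_distrib)
  qed simp
  also have "\<dots> = cis t ^ Suc n * I" unfolding I_def by (rule integral_mult_right_zero)
  also have "cis t ^ Suc n = \<i>"
  proof -
    have "cis t ^ Suc n = cis (real (Suc n) * t)" by (rule Complex.DeMoivre)
    also have "real (Suc n) * t = pi / 2"
      unfolding t_def by (simp del: of_nat_Suc)
    finally show ?thesis by simp
  qed
  finally have "(1 - \<i>) * I = 0" by (simp add: algebra_simps)
  then show ?thesis unfolding I_def by (auto simp: complex_eq_iff)
qed

text \<open>In the Taylor expansion of \<open>z * \<phi> z\<close> at 0 the constant term is
  missing, so every term integrates to 0 over \<open>S\<close>. Since \<open>S\<close> stays in a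
  smaller disc, the partial sums are dominated by a constant.\<close>

lemma integral_rotation_invariant_holomorphic:
  assumes S: "S \<in> sets borel" and rot: "\<And>z w. cmod z = cmod w \<Longrightarrow> z \<in> S \<Longrightarrow> w \<in> S"
    and r: "S \<subseteq> cball 0 r" "0 < r" "r < 1" and \<phi>: "\<phi> holomorphic_on \<Delta>"
  shows "(LINT z|lebesgue_on \<Delta>. indicator S z * z * \<phi> z) = 0"
proof -
  let ?M = "lebesgue_on \<Delta>"
  have S': "S \<inter> \<Delta> = S" using r by (auto simp: subset_iff)
  define a where "a n = (deriv ^^ n) \<phi> 0 / fact n" for n
  have sums: "(\<lambda>n. a n * z ^ n) sums \<phi> z" if "z \<in> \<Delta>" for z
    using holomorphic_power_series[OF \<phi> that] by (simp add: a_def)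
  \<comment> \<open>Convergence at a point of modulus \<open>(r + 1) / 2\<close>, strictly between
    \<open>r\<close> and 1, gives absolute convergence at radius \<open>r\<close>.\<close>
  have "summable (\<lambda>n. a n * complex_of_real ((r + 1) / 2) ^ n)"
    using sums[of "complex_of_real ((r + 1) / 2)"] r(2,3)
    by (auto simp: sums_iff simp del: of_real_divide of_real_add)
  then have summ: "summable (\<lambda>n. cmod (a n) * r ^ n)"
  proof -
    assume "summable (\<lambda>n. a n * complex_of_real ((r + 1) / 2) ^ n)"
    moreover have "cmod (complex_of_real r) < cmod (complex_of_real ((r + 1) / 2))"
      using r by (simp only: norm_of_real) simp
    ultimately have "summable (\<lambda>n. norm (a n * complex_of_real r ^ n))"
      by (rule powser_insidea)
    then show ?thesis using r by (simp add: norm_mult norm_power)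
  qed
  have [measurable]: "indicator S \<in> borel_measurable ?M"
    using S by (intro measurable_restrict_space1 borel_measurable_indicator) auto
  have id [measurable]: "(\<lambda>z. z) \<in> borel_measurable ?M"
    by (intro measurable_restrict_space1 measurable_completion) auto
  have \<phi>m [measurable]: "\<phi> \<in> borel_measurable ?M"
    using \<phi> by (intro continuous_imp_measurable_on_sets_lebesgue holomorphic_on_imp_continuous_on) auto
  have fin: "finite_measure ?M" by (intro finite_measure_lebesgue_on) simp
  define s where "s N z = (\<Sum>n<N. a n * (indicator S z * z ^ Suc n))" for N and z :: complex
  have int0: "(LINT z|?M. indicator S z * z ^ Suc n) = (0 :: complex)" for n
  proof -
    have "(LINT z|?M. indicator S z * z ^ Suc n) = (LINT z|lebesgue. indicator \<Delta> z *\<^sub>R (indicator S z * z ^ Suc n) :: complex)"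
      by (rule integral_restrict_space) simp
    also have "\<dots> = (LINT z|lebesgue. indicator S z * z ^ Suc n)"
      using S' by (intro Bochner_Integration.integral_cong) (auto simp: indicator_def)
    also have "\<dots> = (LINT z|lborel. indicator S z * z ^ Suc n)"
      using S by (intro integral_completion borel_measurable_times borel_measurable_indicator) auto
    also have "\<dots> = 0" using integral_rotation_invariant_power[OF S rot] .
    finally show ?thesis .
  qed
  have int: "integrable ?M (\<lambda>z. indicator S z * z ^ Suc n :: complex)" for n
  proof (rule finite_measure.integrable_const_bound[OF fin, of _ 1])
    show "AE z in ?M. cmod (indicator S z * z ^ Suc n) \<le> 1"
      by (auto simp: indicator_def norm_mult norm_power simp del: power_Suc intro!: power_le_one)
  qed measurable
  have "(\<lambda>N. LINT z|?M. s N z) \<longlonglongrightarrow> (LINT z|?M. indicator S z * z * \<phi> z)"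
  proof (rule integral_dominated_convergence[where w = "\<lambda>_. \<Sum>n. cmod (a n) * r ^ n"])
    show "AE z in ?M. (\<lambda>N. s N z) \<longlonglongrightarrow> indicator S z * z * \<phi> z"
    proof (rule AE_I2)
      fix z assume "z \<in> space ?M"
      then have "z \<in> \<Delta>" by simp
      then have "(\<lambda>n. indicator S z * z * (a n * z ^ n)) sums (indicator S z * z * \<phi> z)"
        by (intro sums_mult sums)
      then show "(\<lambda>N. s N z) \<longlonglongrightarrow> indicator S z * z * \<phi> z"
        unfolding s_def sums_def by (simp add: mult_ac)
    qed
    show "AE z in ?M. cmod (s N z) \<le> (\<Sum>n. cmod (a n) * r ^ n)" for N
    proof (rule AE_I2)
      fix z
      have "cmod (s N z) \<le> (\<Sum>n<N. cmod (a n) * r ^ n)"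
        unfolding s_def
      proof (rule sum_norm_le)
        fix n
        show "cmod (a n * (indicator S z * z ^ Suc n)) \<le> cmod (a n) * r ^ n"
        proof (cases "z \<in> S")
          case True
          then have "cmod z \<le> r" using r by auto
          then have "cmod z ^ Suc n \<le> r ^ Suc n" by (intro power_mono) auto
          also have "\<dots> \<le> r ^ n" using r by (simp add: mult_left_le_one_le)
          finally show ?thesis
            using True by (simp add: norm_mult norm_power mult_left_mono del: power_Suc)
        qed (use r in simp)
      qed
      also have "\<dots> \<le> (\<Sum>n. cmod (a n) * r ^ n)"
        using summ r by (intro sum_le_suminf) auto
      finally show "cmod (s N z) \<le> (\<Sum>n. cmod (a n) * r ^ n)" .
    qed
    show "integrable ?M (\<lambda>_. \<Sum>n. cmod (a n) * r ^ n)"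
      by (rule finite_measure.integrable_const[OF fin])
  qed (unfold s_def, measurable)
  moreover have "(LINT z|?M. s N z) = 0" for N
    unfolding s_def using int int0 by (simp add: del: power_Suc)
  ultimately show ?thesis by (simp add: LIMSEQ_const_iff)
qed

section \<open>A rotation invariant closed set of positive area without interior\<close>

lemma emeasure_annulus:
  fixes c :: complex
  assumes "0 \<le> a" "a \<le> b"
  shows "emeasure lborel (ball c b - ball c a) = ennreal (pi * (b\<^sup>2 - a\<^sup>2))"
proof -
  have "emeasure lborel (ball c b - ball c a) = emeasure lborel (ball c b) - emeasure lborel (ball c a)"
    using assms by (intro emeasure_Diff) (auto simp: emeasure_ball)
  then show ?thesis
    using assms by (simp add: emeasure_ball unit_ball_vol_2 ennreal_minus right_diff_distrib)
qed

text \<open>From a disc of area \<open>pi / 4\<close>, open annuli around the circles of all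
  rational radii are removed. Their total area is at most \<open>pi / 8\<close>, yet they meet every
  radial segment.\<close>

lemma exists_fat_cantor_annuli:
  "\<exists>S :: complex set. closed S \<and> S \<subseteq> cball 0 (1/2) \<and> interior S = {} \<and>
     (\<forall>z w. cmod z = cmod w \<longrightarrow> z \<in> S \<longrightarrow> w \<in> S) \<and> emeasure lborel S \<noteq> 0"
proof -
  define q where "q = from_nat_into (\<rat> \<inter> {0<..<1/2 :: real})"
  have ne: "\<rat> \<inter> {0<..<1/2 :: real} \<noteq> {}"
    using Rats_dense_in_real[of 0 "1/2"] by auto
  have cnt: "countable (\<rat> \<inter> {0<..<1/2 :: real})" using countable_rat by auto
  have q: "0 < q n" "q n < 1/2" for n
    using from_nat_into[OF ne, of n] by (auto simp: q_def)
  \<comment> \<open>The minimum with \<open>q n\<close> keeps the inner radius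
    \<open>q n - e n\<close> nonnegative; the exponent \<open>n + 5\<close> makes the areas sum to
    at most \<open>pi / 8\<close>.\<close>
  define e where "e n = min (q n) (1 / 2 ^ (n + 5))" for n
  have e: "0 < e n" "e n \<le> q n" "e n \<le> (1/32) * (1/2) ^ n" for n
    using q by (auto simp: e_def power_add field_simps min_le_iff_disj)
  define V :: "nat \<Rightarrow> complex set" where "V n = {z. \<bar>cmod z - q n\<bar> < e n}" for n
  define S where "S = cball 0 (1/2) - (\<Union>n. V n)"
  have V: "open (V n)" for n
    unfolding V_def by (intro open_Collect_less continuous_intros)
  have "emeasure lborel (V n) \<le> ennreal (pi / 16 * (1/2) ^ n)" for n
  proof -
    have "V n \<subseteq> ball 0 (q n + e n) - ball 0 (q n - e n)"
      by (auto simp: V_def abs_less_iff)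
    then have "emeasure lborel (V n) \<le> emeasure lborel (ball (0::complex) (q n + e n) - ball 0 (q n - e n))"
      by (intro emeasure_mono) auto
    also have "\<dots> = ennreal (pi * (4 * q n * e n))"
      using e[of n] by (subst emeasure_annulus) (auto simp: power2_eq_square algebra_simps)
    also have "\<dots> \<le> ennreal (pi * (4 * (1/2) * ((1/32) * (1/2) ^ n)))"
      using q[of n] e[of n] by (intro ennreal_leI mult_mono) auto
    finally show ?thesis by simp
  qed
  then have "(\<Sum>n. emeasure lborel (V n)) \<le> (\<Sum>n. ennreal (pi / 16 * (1/2) ^ n))"
    by (intro suminf_le) auto
  also have "\<dots> = ennreal (pi / 16 * 2)"
    using sums_mult[OF power_half_series, of "pi / 16 * 2"] sums_mult[OF geometric_sums[of "1/2::real"], of "pi / 16"]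
    by (intro suminf_ennreal_eq) auto
  finally have V_sum: "(\<Sum>n. emeasure lborel (V n)) \<le> ennreal (pi / 8)" by simp
  have "emeasure lborel S \<noteq> 0"
  proof
    assume 0: "emeasure lborel S = 0"
    have "ennreal (pi / 4) = emeasure lborel (cball 0 (1/2) :: complex set)"
      by (simp add: emeasure_cball unit_ball_vol_2 power2_eq_square)
    also have "\<dots> \<le> emeasure lborel (S \<union> (\<Union>n. V n))"
      using V by (intro emeasure_mono) (auto simp: S_def)
    also have "\<dots> \<le> emeasure lborel S + emeasure lborel (\<Union>n. V n)"
      using V by (intro emeasure_subadditive) (auto simp: S_def)
    also have "\<dots> \<le> (\<Sum>n. emeasure lborel (V n))"
      unfolding 0 using V by (simp add: emeasure_subadditive_countably image_subset_iff)
    also note V_sum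
    finally show False by simp
  qed
  moreover have "interior S = {}"
  proof (rule ccontr)
    assume "interior S \<noteq> {}"
    moreover have "interior S \<noteq> {0}"
      using open_interior[of S] not_open_singleton by metis
    ultimately obtain z where z: "z \<in> interior S" "z \<noteq> 0" by auto
    have z2: "cmod z \<le> 1/2" using z interior_subset[of S] by (auto simp: S_def)
    have "isCont (\<lambda>t. complex_of_real t * z) 1" by (intro continuous_intros)
    then have "\<forall>\<^sub>F t in at 1. complex_of_real t * z \<in> interior S"
      unfolding isCont_def using z by (intro topological_tendstoD) auto
    then obtain d where d: "d > 0" "\<And>t. t \<noteq> 1 \<Longrightarrow> dist t 1 < d \<Longrightarrow> complex_of_real t * z \<in> interior S"
      unfolding eventually_at by auto
    \<comment> \<open>A rational radius just below \<open>cmod z\<close>: scaling \<open>z\<close>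
      to this radius stays inside the interior of \<open>S\<close> but lands on the central circle
      of a removed annulus.\<close>
    obtain x where x: "x \<in> \<rat>" "max 0 ((1 - d) * cmod z) < x" "x < cmod z"
    proof -
      have "max 0 ((1 - d) * cmod z) < cmod z" using z d(1) by (simp add: algebra_simps)
      then show ?thesis using Rats_dense_in_real that by blast
    qed
    define w where "w = complex_of_real (x / cmod z) * z"
    have "x / cmod z < 1" "x / cmod z > 1 - d"
      using x z by (auto simp: field_simps)
    then have "w \<in> interior S"
      unfolding w_def by (intro d(2)) (auto simp: dist_real_def)
    then have "w \<in> S" using interior_subset by blast
    have "cmod w = x"
      using x z unfolding w_def norm_mult norm_of_real by simp
    obtain n where "q n = x"
      using x z2 from_nat_into_surj[OF cnt, of x] by (auto simp: q_def)
    then have "w \<in> V n"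
      unfolding V_def mem_Collect_eq \<open>cmod w = x\<close> \<open>q n = x\<close>[symmetric] using e(1)[of n] by simp
    with \<open>w \<in> S\<close> show False unfolding S_def by blast
  qed
  moreover have "closed S" using V unfolding S_def by (intro closed_Diff open_UN) auto
  moreover have "\<forall>z w. cmod z = cmod w \<longrightarrow> z \<in> S \<longrightarrow> w \<in> S"
    by (auto simp: S_def V_def)
  moreover have "S \<subseteq> cball 0 (1/2)" by (auto simp: S_def)
  ultimately show ?thesis by blast
qed

section \<open>Pole pushing\<close>

definition bounded_holomorphic :: "(complex \<Rightarrow> complex) \<Rightarrow> bool" where
  "bounded_holomorphic g \<longleftrightarrow> g holomorphic_on \<Delta> \<and> bounded (g ` \<Delta>)"

lemma bounded_holomorphicE:
  assumes "bounded_holomorphic g"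
  obtains B where "B > 0" "\<And>z. z \<in> \<Delta> \<Longrightarrow> cmod (g z) \<le> B"
  using assms unfolding bounded_holomorphic_def bounded_pos by auto

lemma bounded_holomorphicI:
  assumes "g holomorphic_on \<Delta>" "\<And>z. z \<in> \<Delta> \<Longrightarrow> cmod (g z) \<le> B"
  shows "bounded_holomorphic g"
  using assms unfolding bounded_holomorphic_def bounded_iff by blast

lemma bounded_holomorphic_add:
  assumes "bounded_holomorphic f" "bounded_holomorphic g"
  shows "bounded_holomorphic (\<lambda>z. f z + g z)"
  using assms bounded_plus_comp[of f \<Delta> g] unfolding bounded_holomorphic_def
  by (auto intro: holomorphic_intros)

lemma bounded_holomorphic_mult:
  assumes "bounded_holomorphic f" "bounded_holomorphic g"
  shows "bounded_holomorphic (\<lambda>z. f z * g z)"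
proof -
  obtain B C where "B > 0" "\<And>z. z \<in> \<Delta> \<Longrightarrow> cmod (f z) \<le> B" "\<And>z. z \<in> \<Delta> \<Longrightarrow> cmod (g z) \<le> C"
    using assms bounded_holomorphicE by metis
  then have "cmod (f z * g z) \<le> B * C" if "z \<in> \<Delta>" for z
    using that by (simp add: norm_mult mult_mono')
  then show ?thesis
    using assms unfolding bounded_holomorphic_def
    by (intro bounded_holomorphicI[unfolded bounded_holomorphic_def] holomorphic_intros) auto
qed

lemma bounded_holomorphic_const: "bounded_holomorphic (\<lambda>z. c)"
  by (rule bounded_holomorphicI[of _ "cmod c"]) auto

text \<open>Only the values of \<open>f\<close> on \<open>K\<close> matter, so \<open>f\<close> may
  have poles in the disc off \<open>K\<close>; holomorphy and boundedness on the whole disc are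
  asked of the approximants alone.\<close>

definition uniformly_approximable :: "complex set \<Rightarrow> (complex \<Rightarrow> complex) \<Rightarrow> bool" where
  "uniformly_approximable K f \<longleftrightarrow>
     (\<forall>e>0. \<exists>g. bounded_holomorphic g \<and> (\<forall>z\<in>K. cmod (f z - g z) < e))"

context
  fixes K :: "complex set"
  assumes K: "K \<subseteq> \<Delta>"
begin

lemma approximable_bounded_holomorphic:
  "bounded_holomorphic f \<Longrightarrow> uniformly_approximable K f"
  unfolding uniformly_approximable_def by (intro allI impI exI[of _ f]) auto

lemma approximable_limit:
  assumes "\<And>e. e > 0 \<Longrightarrow> \<exists>g. uniformly_approximable K g \<and> (\<forall>z\<in>K. cmod (f z - g z) < e)"
  shows "uniformly_approximable K f"
  unfolding uniformly_approximable_def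
proof (intro allI impI)
  fix e :: real assume "e > 0"
  then obtain g where g: "uniformly_approximable K g" "\<forall>z\<in>K. cmod (f z - g z) < e / 2"
    using assms[of "e / 2"] by auto
  obtain h where h: "bounded_holomorphic h" "\<forall>z\<in>K. cmod (g z - h z) < e / 2"
    using g(1) \<open>e > 0\<close> unfolding uniformly_approximable_def by (meson half_gt_zero)
  have "cmod (f z - h z) < e" if "z \<in> K" for z
    using that norm_triangle_ineq[of "f z - g z" "g z - h z"] g(2) h(2) by fastforce
  then show "\<exists>g. bounded_holomorphic g \<and> (\<forall>z\<in>K. cmod (f z - g z) < e)"
    using h(1) by blast
qed

lemma approximable_add:
  assumes "uniformly_approximable K f" "uniformly_approximable K g"
  shows "uniformly_approximable K (\<lambda>z. f z + g z)"
  unfolding uniformly_approximable_def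
proof (intro allI impI)
  fix e :: real assume "e > 0"
  then obtain f' g' where
    f': "bounded_holomorphic f'" "\<forall>z\<in>K. cmod (f z - f' z) < e / 2" and
    g': "bounded_holomorphic g'" "\<forall>z\<in>K. cmod (g z - g' z) < e / 2"
    using assms unfolding uniformly_approximable_def by (meson half_gt_zero)
  have "cmod (f z + g z - (f' z + g' z)) < e" if "z \<in> K" for z
    using that norm_triangle_ineq[of "f z - f' z" "g z - g' z"] f'(2) g'(2)
    by (fastforce simp: algebra_simps)
  then show "\<exists>h. bounded_holomorphic h \<and> (\<forall>z\<in>K. cmod (f z + g z - h z) < e)"
    using bounded_holomorphic_add[OF f'(1) g'(1)] by blast
qed

lemma approximable_imp_bounded:
  assumes "uniformly_approximable K f"
  obtains B where "B > 0" "\<And>z. z \<in> K \<Longrightarrow> cmod (f z) \<le> B"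
proof -
  obtain g where g: "bounded_holomorphic g" "\<forall>z\<in>K. cmod (f z - g z) < 1"
    using assms unfolding uniformly_approximable_def by (meson zero_less_one)
  obtain B where B: "B > 0" "\<And>z. z \<in> \<Delta> \<Longrightarrow> cmod (g z) \<le> B"
    using bounded_holomorphicE[OF g(1)] by blast
  have "cmod (f z) \<le> B + 1" if "z \<in> K" for z
    using norm_triangle_ineq[of "g z" "f z - g z"] g(2) B(2)[of z] that K by fastforce
  with B(1) that[of "B + 1"] show ?thesis by simp
qed

lemma approximable_mult:
  assumes "uniformly_approximable K f" "uniformly_approximable K g"
  shows "uniformly_approximable K (\<lambda>z. f z * g z)"
  unfolding uniformly_approximable_def
proof (intro allI impI)
  fix e :: real assume "e > 0"
  obtain B where B: "B > 0" "\<And>z. z \<in> K \<Longrightarrow> cmod (g z) \<le> B"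
    using approximable_imp_bounded[OF assms(2)] by blast
  obtain f' where f': "bounded_holomorphic f'" "\<forall>z\<in>K. cmod (f z - f' z) < e / 2 / B"
    using assms(1) \<open>e > 0\<close> B(1) unfolding uniformly_approximable_def
    by (meson half_gt_zero divide_pos_pos)
  obtain C where C: "C > 0" "\<And>z. z \<in> \<Delta> \<Longrightarrow> cmod (f' z) \<le> C"
    using bounded_holomorphicE[OF f'(1)] by blast
  \<comment> \<open>\<open>g'\<close> is chosen after \<open>f'\<close>, since its tolerance depends
    on the bound \<open>C\<close> of \<open>f'\<close>.\<close>
  obtain g' where g': "bounded_holomorphic g'" "\<forall>z\<in>K. cmod (g z - g' z) < e / 2 / C"
    using assms(2) \<open>e > 0\<close> C(1) unfolding uniformly_approximable_def
    by (meson half_gt_zero divide_pos_pos)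
  have "cmod (f z * g z - f' z * g' z) < e" if z: "z \<in> K" for z
  proof -
    have "cmod ((f z - f' z) * g z) \<le> cmod (f z - f' z) * B"
      using B z by (simp add: norm_mult mult_left_mono)
    also have "\<dots> < e / 2 / B * B"
      using f'(2) z B(1) by (intro mult_strict_right_mono) auto
    finally have 1: "cmod ((f z - f' z) * g z) < e / 2" using B(1) by simp
    have "cmod (f' z * (g z - g' z)) \<le> C * cmod (g z - g' z)"
      using C z K by (auto simp: norm_mult intro!: mult_right_mono)
    also have "\<dots> < C * (e / 2 / C)"
      using g'(2) z C(1) by (intro mult_strict_left_mono) auto
    finally have 2: "cmod (f' z * (g z - g' z)) < e / 2" using C(1) by simp
    have "f z * g z - f' z * g' z = (f z - f' z) * g z + f' z * (g z - g' z)"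
      by (simp add: algebra_simps)
    then show ?thesis
      using norm_triangle_ineq[of "(f z - f' z) * g z" "f' z * (g z - g' z)"] 1 2 by simp
  qed
  then show "\<exists>h. bounded_holomorphic h \<and> (\<forall>z\<in>K. cmod (f z * g z - h z) < e)"
    using bounded_holomorphic_mult[OF f'(1) g'(1)] by blast
qed

lemma approximable_const: "uniformly_approximable K (\<lambda>z. c)"
  by (rule approximable_bounded_holomorphic bounded_holomorphic_const)+

lemma approximable_power:
  "uniformly_approximable K f \<Longrightarrow> uniformly_approximable K (\<lambda>z. f z ^ n)"
  by (induction n) (simp_all add: approximable_const approximable_mult)

lemma approximable_sum:
  "(\<And>i. i < n \<Longrightarrow> uniformly_approximable K (f i)) \<Longrightarrow> uniformly_approximable K (\<lambda>z. \<Sum>i<(n::nat). f i z)"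
  by (induction n) (simp_all add: approximable_const approximable_add)

text \<open>Expanding \<open>1 / (z - b)\<close> around \<open>a\<close> gives a geometric series in
  \<open>(b - a) / (z - a)\<close>, a ratio of modulus at most 1/2 on \<open>K\<close>. Its partial
  sums are polynomials in \<open>1 / (z - a)\<close>.\<close>

lemma approximable_pole_step:
  assumes a: "uniformly_approximable K (\<lambda>z. 1 / (z - a))"
    and d: "d > 0" "\<And>z. z \<in> K \<Longrightarrow> d \<le> dist z a" "dist a b \<le> d / 2"
  shows "uniformly_approximable K (\<lambda>z. 1 / (z - b))"
proof (rule approximable_limit)
  fix e :: real assume "e > 0"
  \<comment> \<open>The remainder after \<open>n\<close> terms is \<open>q ^ n / (z - b)\<close>,
    and \<open>z\<close> has distance at least \<open>d / 2\<close> from \<open>b\<close>.\<close>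
  have "(\<lambda>n. (1 / 2) ^ n * (2 / d)) \<longlonglongrightarrow> 0 * (2 / d)"
    by (intro tendsto_intros) auto
  then have "\<forall>\<^sub>F n in sequentially. (1 / 2) ^ n * (2 / d) < e"
    using \<open>e > 0\<close> by (auto dest: order_tendstoD)
  then obtain n where n: "(1 / 2) ^ n * (2 / d) < e"
    by (auto simp: eventually_sequentially)
  define S where "S z = (\<Sum>k<n. (b - a) ^ k * (1 / (z - a)) ^ Suc k)" for z
  have "uniformly_approximable K S"
    unfolding S_def
    by (intro approximable_sum approximable_mult approximable_const approximable_power a)
  moreover have "cmod (1 / (z - b) - S z) < e" if "z \<in> K" for z
  proof -
    define q where "q = (b - a) / (z - a)"
    have za: "cmod (z - a) \<ge> d" "z \<noteq> a" using d(2)[OF that] d(1) by (auto simp: dist_norm)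
    have ba: "cmod (b - a) \<le> d / 2" using d(3) by (simp add: dist_norm norm_minus_commute)
    have zb: "cmod (z - b) \<ge> d / 2"
      using norm_triangle_ineq[of "z - b" "b - a"] za ba by simp
    then have "z \<noteq> b" using d(1) by auto
    have "cmod q \<le> (d / 2) / d"
      unfolding q_def norm_divide using za(1) ba d(1) by (intro frac_le) auto
    then have q: "cmod q \<le> 1 / 2" using d(1) by simp
    then have "q \<noteq> 1" by auto
    have "S z = 1 / (z - a) * (\<Sum>k<n. q ^ k)"
      unfolding S_def q_def sum_distrib_left
      by (intro sum.cong refl) (simp add: power_divide)
    also have "\<dots> = 1 / (z - a) * ((1 - q ^ n) / (1 - q))"
      using \<open>q \<noteq> 1\<close> by (simp add: sum_gp_strict)
    also have "\<dots> = (1 - q ^ n) / (z - b)"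
    proof -
      have "(z - a) * (1 - q) = z - b" using za(2) by (simp add: q_def field_simps)
      then show ?thesis by simp
    qed
    finally have "1 / (z - b) - S z = q ^ n / (z - b)" by (simp add: diff_divide_distrib)
    then have "cmod (1 / (z - b) - S z) = cmod q ^ n / cmod (z - b)"
      by (simp add: norm_divide norm_power)
    also have "\<dots> \<le> (1 / 2) ^ n / (d / 2)"
      using q zb d(1) by (intro frac_le power_mono) auto
    also have "\<dots> < e" using n by simp
    finally show ?thesis .
  qed
  ultimately show "\<exists>g. uniformly_approximable K g \<and> (\<forall>z\<in>K. cmod (1 / (z - b) - g z) < e)"
    by blast
qed

text \<open>A pole is pushed along the circle in small steps until it leaves the disc.\<close>
lemma approximable_pole_on_circle:
  assumes d: "d > 0" "\<And>z w. z \<in> K \<Longrightarrow> dist w c = r \<Longrightarrow> d \<le> dist z w"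
    and r: "r > 0" and out: "dist a c = r" "cmod a > 1" and b: "dist b c = r"
  shows "uniformly_approximable K (\<lambda>z. 1 / (z - b))"
proof -
  obtain t where t: "b - c = (a - c) * cis t"
  proof -
    have "cmod ((b - c) / (a - c)) = 1"
      using out(1) b r by (simp add: dist_norm norm_divide)
    then have "(b - c) / (a - c) = cis (Arg ((b - c) / (a - c)))"
      by (metis cis_Arg div_by_1 norm_eq_zero of_real_1 sgn_eq zero_neq_one)
    then have "b - c = (a - c) * cis (Arg ((b - c) / (a - c)))"
      using out(1) r by (auto simp: dist_norm field_simps)
    then show ?thesis by (rule that)
  qed
  obtain n :: nat where n: "n > 0" "r * \<bar>t\<bar> / (d / 2) < real n"
    using reals_Archimedean2 d(1)
    by (metis gr0I less_le_not_le linorder_not_less of_nat_0 order.trans divide_nonneg_pos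
        half_gt_zero mult_nonneg_nonneg abs_ge_zero r less_imp_le)
  \<comment> \<open>The points run from the exterior pole \<open>a\<close> to \<open>b\<close>, so
    the induction starts with a bounded holomorphic function. By the choice of \<open>n\<close>,
    each arc, and hence each chord, has length at most \<open>d / 2\<close>.\<close>
  define p where "p k = c + (a - c) * cis (real k * (t / n))" for k
  have pc: "dist (p k) c = r" for k
    using out(1) by (simp add: p_def dist_norm norm_mult)
  have step: "dist (p k) (p (Suc k)) \<le> d / 2" for k
  proof -
    have "cis (real (Suc k) * (t / n)) = cis (real k * (t / n)) * cis (t / n)"
      by (simp add: cis_mult distrib_right add_divide_distrib add.commute)
    then have "p (Suc k) - p k = (a - c) * cis (real k * (t / n)) * (cis (t / n) - 1)"
      unfolding p_def by (simp only:) (simp add: algebra_simps)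
    then have "dist (p k) (p (Suc k)) = r * cmod (cis (t / n) - 1)"
      using out(1) by (subst dist_commute) (simp add: dist_norm norm_mult)
    also have "\<dots> \<le> r * \<bar>t / n\<bar>"
    proof (rule mult_left_mono)
      have "cmod (cis (t / n) - 1) = 2 * \<bar>sin (t / n / 2)\<bar>"
        using dist_exp_i_1[of "t / n"] by (simp only: cis_conv_exp of_real_divide)
      also have "\<dots> \<le> 2 * \<bar>t / n / 2\<bar>"
        by (intro mult_left_mono abs_sin_x_le_abs_x) simp
      finally show "cmod (cis (t / n) - 1) \<le> \<bar>t / n\<bar>" by simp
    qed (use r in simp)
    also have "\<dots> \<le> d / 2" using n d(1) by (simp add: field_simps)
    finally show ?thesis .
  qed
  have "uniformly_approximable K (\<lambda>z. 1 / (z - p k))" for k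
  proof (induction k)
    case 0
    have "bounded_holomorphic (\<lambda>z. 1 / (z - a))"
    proof (rule bounded_holomorphicI)
      show "(\<lambda>z. 1 / (z - a)) holomorphic_on \<Delta>"
        using out(2) by (intro holomorphic_intros) auto
      show "cmod (1 / (z - a)) \<le> 1 / (cmod a - 1)" if "z \<in> \<Delta>" for z
        using that out(2) norm_triangle_ineq2[of a z]
        by (auto simp: norm_divide norm_minus_commute intro!: frac_le)
    qed
    then show ?case by (simp add: p_def approximable_bounded_holomorphic)
  next
    case (Suc k)
    show ?case
      by (rule approximable_pole_step[OF Suc d(1) d(2)[OF _ pc] step])
  qed
  moreover have "p n = b" using n(1) by (simp add: p_def flip: t)
  ultimately show ?thesis by metis
qed

text \<open>With \<open>s = csqrt w\<close>, the factorisation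
  \<open>1 - w * u^2 = (1 - s * u) * (1 + s * u)\<close> reduces each doubling of the exponent to a
  product of two functions with unimodular coefficients.\<close>

lemma approximable_inverse_power:
  assumes "\<And>w. cmod w = 1 \<Longrightarrow> uniformly_approximable K (\<lambda>z. 1 / (1 - w * F z))"
    and "cmod w = 1"
  shows "uniformly_approximable K (\<lambda>z. 1 / (1 - w * F z ^ (2 ^ m)))"
  using assms(2)
proof (induction m arbitrary: w)
  case 0
  then show ?case using assms(1) by simp
next
  case (Suc m)
  have s: "cmod (csqrt w) = 1" using Suc.prems by (simp add: norm_csqrt)
  have "uniformly_approximable K
      (\<lambda>z. 1 / (1 - csqrt w * F z ^ 2 ^ m) * (1 / (1 - (- csqrt w) * F z ^ 2 ^ m)))"
    using s by (intro approximable_mult Suc.IH) auto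
  moreover have "(1 - csqrt w * F z ^ 2 ^ m) * (1 - (- csqrt w) * F z ^ 2 ^ m) = 1 - w * F z ^ 2 ^ Suc m" for z
  proof -
    have "(1 - csqrt w * F z ^ 2 ^ m) * (1 - (- csqrt w) * F z ^ 2 ^ m)
        = 1 - (csqrt w)\<^sup>2 * (F z ^ 2 ^ m)\<^sup>2"
      by (simp add: algebra_simps power2_eq_square)
    then show ?thesis by (simp add: power_mult mult.commute flip: power_mult)
  qed
  ultimately show ?case by (simp flip: times_divide_times_eq)
qed

end


text \<open>For a large exponent \<open>N\<close>, the function \<open>1 / (1 - F z ^ N)\<close> is
  near 1 inside the circle \<open>cmod (F z) = 1\<close> and near 0 outside. Its poles lie on that
  circle, which reaches beyond the disc, so they can be pushed out; a negative multiple of the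
  approximant is the desired \<open>g\<close>.\<close>

lemma exists_separating_bounded_holomorphic:
  fixes M \<epsilon> \<delta> :: real
  assumes "M \<ge> 0" "\<epsilon> > 0" "\<delta> > 0"
  shows "\<exists>g. bounded_holomorphic g \<and>
           (\<forall>z\<in>\<Delta>. cmod (z + 1) \<le> 3/2 \<longrightarrow> Re (g z) \<le> - M) \<and>
           (\<forall>z\<in>\<Delta>. cmod (z + 1) \<ge> 3/2 + \<delta> \<longrightarrow> cmod (g z) \<le> \<epsilon>)"
proof -
  \<comment> \<open>The middle circle of the collar, at distance at least
    \<open>\<delta> / 2\<close> from \<open>K\<close>.\<close>
  define \<rho> where "\<rho> = 3/2 + \<delta> / 2"
  define K where "K = {z\<in>\<Delta>. cmod (z + 1) \<le> 3/2 \<or> cmod (z + 1) \<ge> 3/2 + \<delta>}"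
  define F where "F z = (z + 1) / complex_of_real \<rho>" for z
  have \<rho>: "\<rho> > 3/2" "\<rho> < 3/2 + \<delta>" using assms by (auto simp: \<rho>_def)
  have K: "K \<subseteq> \<Delta>" by (auto simp: K_def)
  have far: "\<delta> / 2 \<le> dist z w" if "z \<in> K" "dist w (-1) = \<rho>" for z w
  proof -
    have "dist z (-1) \<le> 3/2 \<or> dist z (-1) \<ge> 3/2 + \<delta>"
      using that(1) by (auto simp: K_def dist_norm)
    then show ?thesis
      using that(2) dist_triangle[of z "-1" w] dist_triangle[of w "-1" z]
      unfolding \<rho>_def by (auto simp: dist_commute)
  qed
  have pole: "uniformly_approximable K (\<lambda>z. 1 / (1 - w * F z))" if w: "cmod w = 1" for w
  proof -
    \<comment> \<open>The solution of \<open>w * F b = 1\<close>, that is, the pole.\<close>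
    define b where "b = \<rho> / w - 1"
    have "w \<noteq> 0" using w by auto
    have "uniformly_approximable K (\<lambda>z. 1 / (z - b))"
    proof (rule approximable_pole_on_circle[OF K])
      show "0 < \<delta> / 2" "0 < \<rho>" using assms \<rho> by auto
      show "\<delta> / 2 \<le> dist z w" if "z \<in> K" "dist w (-1) = \<rho>" for z w
        using far that .
      \<comment> \<open>The pushing starts from the leftmost point of the circle, which lies outside
        the closed unit disc.\<close>
      show "dist (complex_of_real (- 1 - \<rho>)) (-1) = \<rho>" using \<rho> by (simp add: dist_norm)
      show "1 < cmod (complex_of_real (- 1 - \<rho>))" using \<rho> by (simp only: norm_of_real)
      show "dist b (-1) = \<rho>" using \<rho> w by (simp add: b_def dist_norm norm_divide)
    qed
    then have "uniformly_approximable K (\<lambda>z. (- \<rho> / w) * (1 / (z - b)))"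
      by (intro approximable_mult[OF K] approximable_const[OF K])
    moreover have "(- \<rho> / w) * (1 / (z - b)) = 1 / (1 - w * F z)" for z
    proof -
      have "1 - w * F z = (z - b) / (- \<rho> / w)"
        using \<rho> \<open>w \<noteq> 0\<close> by (simp add: F_def b_def field_simps)
      then show ?thesis by simp
    qed
    ultimately show ?thesis by simp
  qed
  \<comment> \<open>The bound 1/4 keeps \<open>h\<close> within 1/2 of 1 on the inner part; the
    other bound makes \<open>2 * (M + 1) * (2 * e)\<close> at most \<open>\<epsilon>\<close> on the
    outer part.\<close>
  define e where "e = min (1 / 4) (\<epsilon> / (4 * (M + 1)))"
  have e: "e > 0" "e \<le> 1 / 4"
    using assms unfolding e_def by (simp, intro min.cobounded1)
  have "4 * (M + 1) * e \<le> 4 * (M + 1) * (\<epsilon> / (4 * (M + 1)))"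
    using assms unfolding e_def by (intro mult_left_mono) auto
  then have e3: "4 * (M + 1) * e \<le> \<epsilon>" using assms by simp
  define q where "q = (3/2) / \<rho>"
  define Q where "Q = (3/2 + \<delta>) / \<rho>"
  have q: "0 \<le> q" "q < 1" and Q: "Q > 1" using \<rho> by (auto simp: q_def Q_def)
  \<comment> \<open>Below 1/5, \<open>u / (1 - u)\<close> has modulus at most 1/4; above
    \<open>1 + 1 / e\<close>, \<open>1 / (1 - u)\<close> has modulus at most \<open>e\<close>. Both
    exponents are then raised to a common power of two.\<close>
  obtain n1 where n1: "q ^ n1 < 1 / 5" using real_arch_pow_inv[of "1/5" q] q by auto
  obtain n2 where n2: "1 + 1 / e < Q ^ n2" using real_arch_pow[OF Q] by blast
  obtain m :: nat where m: "n1 \<le> 2 ^ m" "n2 \<le> 2 ^ m"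
    by (metis less_exp less_imp_le max.bounded_iff)
  have qm: "q ^ 2 ^ m < 1 / 5"
    using power_decreasing[OF m(1), of q] q n1 by simp
  have Qm: "1 + 1 / e < Q ^ 2 ^ m"
    using power_increasing[OF m(2), of Q] Q n2 by linarith
  obtain h where h: "bounded_holomorphic h" "\<forall>z\<in>K. cmod (1 / (1 - 1 * F z ^ 2 ^ m) - h z) < e"
    using approximable_inverse_power[OF K pole, of 1 m] e(1) unfolding uniformly_approximable_def
    by auto
  \<comment> \<open>On the inner part \<open>Re (h z)\<close> is at least 1/2, so this factor gives
    real part at most \<open>- (M + 1)\<close>.\<close>
  define g where "g z = complex_of_real (- 2 * (M + 1)) * h z" for z
  have cF: "cmod (F z) = cmod (z + 1) / \<rho>" for z using \<rho> by (simp add: F_def norm_divide)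
  show ?thesis
  proof (intro exI[of _ g] conjI ballI impI)
    show "bounded_holomorphic g"
      unfolding g_def by (intro bounded_holomorphic_mult bounded_holomorphic_const h)
    fix z :: complex assume z: "z \<in> \<Delta>"
    define u where "u = F z ^ 2 ^ m"
    {
      assume "cmod (z + 1) \<le> 3/2"
      then have "z \<in> K" "cmod (F z) \<le> q"
        using z \<rho> unfolding cF q_def by (auto simp: K_def simp del: divide_divide_eq_left intro!: divide_right_mono)
      have hz: "cmod (1 / (1 - u) - h z) < e" using h(2) \<open>z \<in> K\<close> by (auto simp: u_def)
      have "cmod u \<le> q ^ 2 ^ m"
        unfolding u_def norm_power using \<open>cmod (F z) \<le> q\<close> by (intro power_mono) auto
      then have u: "cmod u \<le> 1 / 5" using qm by simp
      then have "cmod (1 - u) \<ge> 4 / 5" using norm_triangle_ineq2[of 1 u] by simp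
      then have "cmod (u / (1 - u)) \<le> (1 / 5) / (4 / 5)"
        unfolding norm_divide using u by (intro frac_le) auto
      moreover have "u / (1 - u) = 1 / (1 - u) - 1"
        using u by (cases "u = 1") (auto simp: field_simps)
      ultimately have "cmod (1 / (1 - u) - 1) \<le> 1 / 4" by simp
      then have "cmod (h z - 1) \<le> 1 / 2"
        using hz e(2) norm_triangle_ineq4[of "1 / (1 - u) - 1" "1 / (1 - u) - h z"] by simp
      then have "Re (h z) \<ge> 1 / 2" using abs_Re_le_cmod[of "h z - 1"] by simp
      then have "2 * (M + 1) * (1 / 2) \<le> 2 * (M + 1) * Re (h z)"
        using assms by (intro mult_left_mono) auto
      then show "Re (g z) \<le> - M" by (simp add: g_def algebra_simps)
    }
    {
      assume "cmod (z + 1) \<ge> 3/2 + \<delta>"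
      then have "z \<in> K" "cmod (F z) \<ge> Q"
        using z \<rho> unfolding cF Q_def by (auto simp: K_def simp del: divide_divide_eq_left intro!: divide_right_mono)
      have hz: "cmod (1 / (1 - u) - h z) < e" using h(2) \<open>z \<in> K\<close> by (auto simp: u_def)
      have "cmod u \<ge> Q ^ 2 ^ m"
        unfolding u_def norm_power using \<open>cmod (F z) \<ge> Q\<close> Q by (intro power_mono) auto
      then have "cmod (1 - u) \<ge> 1 / e"
        using Qm norm_triangle_ineq2[of u 1] by (simp add: norm_minus_commute)
      then have "cmod (1 / (1 - u)) \<le> 1 / (1 / e)"
        unfolding norm_divide using e(1) by (intro frac_le) auto
      then have "cmod (h z) \<le> 2 * e"
        using hz norm_triangle_ineq4[of "1 / (1 - u)" "1 / (1 - u) - h z"] by simp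
      then have "2 * (M + 1) * cmod (h z) \<le> 2 * (M + 1) * (2 * e)"
        using assms by (intro mult_left_mono) auto
      moreover have "cmod (g z) = 2 * (M + 1) * cmod (h z)"
        using assms by (simp only: g_def norm_mult norm_of_real) simp
      ultimately show "cmod (g z) \<le> \<epsilon>" using e3 by (simp add: algebra_simps)
    }
  qed
qed

section \<open>A degenerating sequence of quadratic differentials\<close>

text \<open>The bound on increments is asked only from \<open>n\<close> on: a point outside the
  circle has controlled increments only once the collars have shrunk past it.\<close>

lemma geometric_increments_limit:
  fixes x :: "nat \<Rightarrow> 'a::banach"
  assumes "\<And>m. m \<ge> n \<Longrightarrow> norm (x (Suc m) - x m) \<le> C * (1/2) ^ m"
  shows "x \<longlonglongrightarrow> lim x" and "norm (x n - lim x) \<le> 2 * C * (1/2) ^ n"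
proof -
  define d where "d k = x (Suc (n + k)) - x (n + k)" for k
  have d: "norm (d k) \<le> C * (1/2) ^ n * (1/2) ^ k" for k
    using assms[of "n + k"] by (simp add: d_def power_add mult_ac)
  have geo: "(\<lambda>k. C * (1/2) ^ n * (1/2) ^ k) sums (C * (1/2) ^ n * 2)"
    using sums_mult[OF geometric_sums[of "1/2::real"], of "C * (1/2) ^ n"] by simp
  have sn: "summable (\<lambda>k. norm (d k))"
    by (rule summable_comparison_test'[OF sums_summable[OF geo], of 0]) (simp add: d)
  have "(\<Sum>k<N. d k) = x (N + n) - x n" for N
    unfolding d_def using sum_lessThan_telescope[of "\<lambda>k. x (n + k)" N] by (simp add: add.commute)
  then have "(\<lambda>N. x (N + n) - x n) \<longlonglongrightarrow> (\<Sum>k. d k)"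
    using summable_LIMSEQ[OF summable_norm_cancel[OF sn]] by simp
  then have "(\<lambda>N. x (N + n) - x n + x n) \<longlonglongrightarrow> (\<Sum>k. d k) + x n"
    by (intro tendsto_intros)
  then have "x \<longlonglongrightarrow> (\<Sum>k. d k) + x n"
    by (simp add: LIMSEQ_offset)
  moreover from this have l: "lim x = (\<Sum>k. d k) + x n" by (rule limI)
  ultimately show "x \<longlonglongrightarrow> lim x" by simp
  have "norm (\<Sum>k. d k) \<le> (\<Sum>k. norm (d k))" by (rule summable_norm[OF sn])
  also have "\<dots> \<le> C * (1/2) ^ n * 2"
    using suminf_le[OF d sn sums_summable[OF geo]] sums_unique[OF geo] by simp
  finally show "norm (x n - lim x) \<le> 2 * C * (1/2) ^ n"
    unfolding l by (simp add: mult_ac)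
qed

lemma one_minus_cos_le_abs: "1 - cos x \<le> \<bar>x\<bar>" for x :: real
proof -
  have "1 - cos x = 2 * \<bar>sin (x / 2)\<bar> * \<bar>sin (x / 2)\<bar>"
    using cos_double_sin[of "x / 2"] by (simp add: power2_eq_square)
  also have "\<dots> \<le> 2 * \<bar>sin (x / 2)\<bar> * 1" by (intro mult_left_mono) auto
  also have "\<dots> \<le> \<bar>x\<bar>" using abs_sin_x_le_abs_x[of "x / 2"] by simp
  finally show ?thesis .
qed

text \<open>Each step adds a separating function. Since \<open>exp (G n z)\<close> can be as large
  as \<open>exp (c n)\<close>, both the collar width and the permitted change carry the factor
  \<open>exp (- c n)\<close>; the 16 offsets the constant in \<open>measure_collar\<close>.\<close>

lemma exists_exponent_sequence:
  "\<exists>(G :: nat \<Rightarrow> complex \<Rightarrow> complex) c :: nat \<Rightarrow> real. \<forall>n.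
     bounded_holomorphic (G n) \<and> 0 \<le> c n \<and> (\<forall>z\<in>\<Delta>. cmod (G n z) \<le> c n) \<and> c n \<le> c (Suc n) \<and>
     (\<forall>z\<in>\<Delta>. cmod (z + 1) \<le> 3/2 \<longrightarrow> Re (G (Suc n) z) \<le> - real n) \<and>
     (\<forall>z\<in>\<Delta>. cmod (z + 1) \<ge> 3/2 + (1/2) ^ n * exp (- c n) / 16 \<longrightarrow>
        cmod (G (Suc n) z - G n z) \<le> (1/2) ^ n * exp (- c n))"
proof -
  \<comment> \<open>The bound is part of the recursive state because the tolerances of the next step
    depend on it.\<close>
  define P :: "nat \<Rightarrow> (complex \<Rightarrow> complex) \<times> real \<Rightarrow> bool"
    where "P n x \<longleftrightarrow> bounded_holomorphic (fst x) \<and> 0 \<le> snd x \<and> (\<forall>z\<in>\<Delta>. cmod (fst x z) \<le> snd x)" for n x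
  define Q :: "nat \<Rightarrow> (complex \<Rightarrow> complex) \<times> real \<Rightarrow> (complex \<Rightarrow> complex) \<times> real \<Rightarrow> bool"
    where "Q n x y \<longleftrightarrow> snd x \<le> snd y \<and>
     (\<forall>z\<in>\<Delta>. cmod (z + 1) \<le> 3/2 \<longrightarrow> Re (fst y z) \<le> - real n) \<and>
     (\<forall>z\<in>\<Delta>. cmod (z + 1) \<ge> 3/2 + (1/2) ^ n * exp (- snd x) / 16 \<longrightarrow>
        cmod (fst y z - fst x z) \<le> (1/2) ^ n * exp (- snd x))" for n x y
  have "\<exists>f. \<forall>n. P n (f n) \<and> Q n (f n) (f (Suc n))"
  proof (rule dependent_nat_choice)
    show "\<exists>x. P 0 x" by (rule exI[of _ "(\<lambda>_. 0, 0)"]) (simp add: P_def bounded_holomorphic_const)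
    fix x n assume "P n x"
    then obtain G c where x: "x = (G, c)" "bounded_holomorphic G" "c \<ge> 0" "\<forall>z\<in>\<Delta>. cmod (G z) \<le> c"
      by (cases x) (auto simp: P_def)
    \<comment> \<open>The depth \<open>c + real n\<close> first cancels the possible size
      \<open>c\<close> of \<open>G\<close> and then leaves \<open>- real n\<close>.\<close>
    obtain g where g: "bounded_holomorphic g"
      "\<forall>z\<in>\<Delta>. cmod (z + 1) \<le> 3/2 \<longrightarrow> Re (g z) \<le> - (c + real n)"
      "\<forall>z\<in>\<Delta>. cmod (z + 1) \<ge> 3/2 + (1/2) ^ n * exp (- c) / 16 \<longrightarrow> cmod (g z) \<le> (1/2) ^ n * exp (- c)"
      using exists_separating_bounded_holomorphic[of "c + real n" "(1/2) ^ n * exp (- c)" "(1/2) ^ n * exp (- c) / 16"] x(3)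
      by auto
    obtain B where B: "B > 0" "\<And>z. z \<in> \<Delta> \<Longrightarrow> cmod (g z) \<le> B"
      using bounded_holomorphicE[OF g(1)] by blast
    have "Re (G z + g z) \<le> - real n" if "z \<in> \<Delta>" "cmod (z + 1) \<le> 3/2" for z
      using that g(2) x(4) complex_Re_le_cmod[of "G z"] by fastforce
    moreover have "cmod (G z + g z) \<le> c + B" if "z \<in> \<Delta>" for z
      using that B(2) x(4) by (meson add_mono norm_triangle_le)
    ultimately have "P (Suc n) (\<lambda>z. G z + g z, c + B) \<and> Q n x (\<lambda>z. G z + g z, c + B)"
      using x g B(1) bounded_holomorphic_add[OF x(2) g(1)] by (auto simp: P_def Q_def)
    then show "\<exists>y. P (Suc n) y \<and> Q n x y" by blast
  qed
  then obtain f where f: "\<And>n. P n (f n)" "\<And>n. Q n (f n) (f (Suc n))" by blast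
  then show ?thesis
    by (intro exI[of _ "\<lambda>n. fst (f n)"] exI[of _ "\<lambda>n. snd (f n)"]) (simp add: P_def Q_def)
qed

section \<open>Measurability, integrability and the area of a collar\<close>

lemma bounded_holomorphic_measurable:
  "bounded_holomorphic f \<Longrightarrow> f \<in> borel_measurable (lebesgue_on \<Delta>)"
  unfolding bounded_holomorphic_def
  by (intro continuous_imp_measurable_on_sets_lebesgue holomorphic_on_imp_continuous_on) auto

lemma finite_measure_disc: "finite_measure (lebesgue_on \<Delta>)"
  by (intro finite_measure_lebesgue_on) simp

lemma bounded_holomorphic_QD:
  assumes "bounded_holomorphic f"
  shows "f \<in> QD"
proof -
  obtain B where "B > 0" "\<And>z. z \<in> \<Delta> \<Longrightarrow> cmod (f z) \<le> B"
    using bounded_holomorphicE[OF assms] by blast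
  then have "integrable (lebesgue_on \<Delta>) f"
    by (intro finite_measure.integrable_const_bound[OF finite_measure_disc, of _ B]
        bounded_holomorphic_measurable assms AE_I2) auto
  then show ?thesis using assms by (simp add: QD_def bounded_holomorphic_def)
qed

lemma measure_collar:
  assumes "0 < d" "d \<le> 1"
  shows "{z\<in>\<Delta>. 3/2 < cmod (z + 1) \<and> cmod (z + 1) < 3/2 + d} \<in> sets (lebesgue_on \<Delta>)"
    and "measure (lebesgue_on \<Delta>) {z\<in>\<Delta>. 3/2 < cmod (z + 1) \<and> cmod (z + 1) < 3/2 + d} \<le> 16 * d"
proof -
  let ?L = "{z\<in>\<Delta>. 3/2 < cmod (z + 1) \<and> cmod (z + 1) < 3/2 + d}"
  have "?L = \<Delta> \<inter> {z. 3/2 < cmod (z + 1)} \<inter> {z. cmod (z + 1) < 3/2 + d}" by auto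
  then have op: "open ?L" by (auto intro!: open_Int open_Collect_less continuous_intros)
  then show s: "?L \<in> sets (lebesgue_on \<Delta>)" 
    by (intro sets_restrict_space_iff[THEN iffD2]) (auto simp: borel_open)
  have "emeasure (lebesgue_on \<Delta>) ?L = emeasure lborel ?L"
    using op by (subst emeasure_restrict_space) auto
  also have "\<dots> \<le> emeasure lborel (ball (-1) (3/2 + d) - ball (-1) (3/2) :: complex set)"
    by (intro emeasure_mono) (auto simp: dist_norm norm_minus_commute)
  also have "\<dots> = ennreal (pi * ((3/2 + d)\<^sup>2 - (3/2)\<^sup>2))"
    using assms by (intro emeasure_annulus) auto
  also have "\<dots> \<le> ennreal (16 * d)"
  proof (rule ennreal_leI)
    have "(3/2 + d)\<^sup>2 - (3/2)\<^sup>2 = d * (3 + d)" by (simp add: power2_eq_square algebra_simps)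
    also have "\<dots> \<le> d * 4" using assms by (intro mult_left_mono) auto
    finally have "pi * ((3/2 + d)\<^sup>2 - (3/2)\<^sup>2) \<le> 4 * (d * 4)"
      using pi_less_4 assms by (intro mult_mono) (auto simp: power2_eq_square algebra_simps)
    then show "pi * ((3/2 + d)\<^sup>2 - (3/2)\<^sup>2) \<le> 16 * d" by simp
  qed
  finally show "measure (lebesgue_on \<Delta>) ?L \<le> 16 * d"
    unfolding measure_def using assms by (intro enn2real_leI) auto
qed

text \<open>The functions \<open>\<phi> n\<close> form a Hamilton sequence for \<open>\<mu>\<close>
  even though \<open>\<mu>\<close> vanishes on a set of positive area: there the
  \<open>\<phi> n\<close> tend uniformly to 0 and contribute nothing in the limit.\<close>

lemma exists_phase_function:
  "\<exists>(\<mu> :: complex \<Rightarrow> complex) \<phi> \<Phi>. \<mu> \<in> borel_measurable (lebesgue_on \<Delta>) \<and>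
     (\<forall>z. cmod (z + 1) \<le> 3/2 \<longrightarrow> \<mu> z = 0) \<and>
     (\<forall>n. \<phi> n \<in> QD) \<and>
     (\<forall>z\<in>\<Delta>. 3/2 < cmod (z + 1) \<longrightarrow>
        (\<lambda>n. \<phi> n z) \<longlonglongrightarrow> \<Phi> z \<and> \<Phi> z \<noteq> 0 \<and> \<mu> z = cnj (sgn (\<Phi> z))) \<and>
     (\<lambda>n. LINT z|lebesgue_on \<Delta>. cmod (\<phi> n z) - Re (\<mu> z * \<phi> n z)) \<longlonglongrightarrow> 0"
proof -
  let ?M = "lebesgue_on \<Delta>"
  obtain G c where hol: "\<And>n. bounded_holomorphic (G n)" and c0: "\<And>n::nat. 0 \<le> c n"
    and Gc: "\<And>n z. z \<in> \<Delta> \<Longrightarrow> cmod (G n z) \<le> c n" and c_Suc: "\<And>n. c n \<le> c (Suc n)"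
    and small: "\<And>n z. z \<in> \<Delta> \<Longrightarrow> cmod (z + 1) \<le> 3/2 \<Longrightarrow> Re (G (Suc n) z) \<le> - real n"
    and step: "\<And>n z. z \<in> \<Delta> \<Longrightarrow> cmod (z + 1) \<ge> 3/2 + (1/2) ^ n * exp (- c n) / 16 \<Longrightarrow>
        cmod (G (Suc n) z - G n z) \<le> (1/2) ^ n * exp (- c n)"
    using exists_exponent_sequence by metis
  define \<delta> where "\<delta> n = (1/2) ^ n * exp (- c n) / 16" for n
  have c_mono: "c m \<le> c n" if "m \<le> n" for m n using lift_Suc_mono_le[of c] c_Suc that by blast
  have \<delta>: "0 < \<delta> n" "\<delta> n \<le> (1/2) ^ n" "\<delta> n \<le> 1" for n
  proof -
    show "0 < \<delta> n" by (simp add: \<delta>_def)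
    have "(1/2) ^ n * exp (- c n) \<le> (1/2) ^ n * (1::real)" using c0 by (intro mult_left_mono) auto
    moreover have "0 \<le> (1/2) ^ n * exp (- c n)" by simp
    ultimately show "\<delta> n \<le> (1/2) ^ n" unfolding \<delta>_def by linarith
    also have "(1/2) ^ n \<le> (1::real)" by (simp add: power_le_one)
    finally show "\<delta> n \<le> 1" .
  qed
  have \<delta>_mono: "\<delta> n \<le> \<delta> m" if "m \<le> n" for m n
    unfolding \<delta>_def using c_mono[OF that] that
    by (intro divide_right_mono mult_mono power_decreasing) auto
  define \<Gamma> where "\<Gamma> z = lim (\<lambda>n. G n z)" for z
  define \<mu> where "\<mu> z = (if cmod (z + 1) \<le> 3/2 then 0 else cis (- Im (\<Gamma> z)))" for z
  \<comment> \<open>The index is shifted because the decay inside the circle is available only for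
    \<open>G (Suc n)\<close>.\<close>
  define \<phi> where "\<phi> n z = exp (G (Suc n) z)" for n z
  \<comment> \<open>The collars are nested, so outside the \<open>n\<close>-th one all later
    increments are controlled as well.\<close>
  have conv: "(\<lambda>n. G n z) \<longlonglongrightarrow> \<Gamma> z" "cmod (G n z - \<Gamma> z) \<le> 2 * exp (- c n) * (1/2) ^ n"
    if z: "z \<in> \<Delta>" "cmod (z + 1) \<ge> 3/2 + \<delta> n" for n z
  proof -
    have "cmod (G (Suc m) z - G m z) \<le> exp (- c n) * (1/2) ^ m" if "m \<ge> n" for m
    proof -
      have "cmod (z + 1) \<ge> 3/2 + \<delta> m" using z(2) \<delta>_mono[OF that] by simp
      then have "cmod (G (Suc m) z - G m z) \<le> (1/2) ^ m * exp (- c m)"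
        using step z(1) by (simp add: \<delta>_def)
      also have "\<dots> \<le> (1/2) ^ m * exp (- c n)" using c_mono[OF that] by (intro mult_left_mono) auto
      finally show ?thesis by (simp add: mult.commute)
    qed
    from geometric_increments_limit[of n "\<lambda>n. G n z", OF this]
    show "(\<lambda>n. G n z) \<longlonglongrightarrow> \<Gamma> z" "cmod (G n z - \<Gamma> z) \<le> 2 * exp (- c n) * (1/2) ^ n"
      by (simp_all add: \<Gamma>_def)
  qed
  have tends: "(\<lambda>n. G n z) \<longlonglongrightarrow> \<Gamma> z" if z: "z \<in> \<Delta>" "3/2 < cmod (z + 1)" for z
  proof -
    obtain n where "(1/2) ^ n < cmod (z + 1) - 3/2"
      using real_arch_pow_inv[of "cmod (z + 1) - 3/2" "1/2"] z by auto
    then show ?thesis using conv(1)[of z n] \<delta>(2)[of n] z by simp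
  qed
  have id [measurable]: "(\<lambda>z. z) \<in> borel_measurable ?M"
    by (intro measurable_restrict_space1 measurable_completion) auto
  have [measurable]: "G n \<in> borel_measurable ?M" for n
    by (rule bounded_holomorphic_measurable[OF hol])
  have [measurable]: "\<Gamma> \<in> borel_measurable ?M"
    unfolding \<Gamma>_def by (rule borel_measurable_lim_metric) measurable
  have \<mu>_meas [measurable]: "\<mu> \<in> borel_measurable ?M"
    unfolding \<mu>_def cis_conv_exp by measurable
  have \<mu>1: "cmod (\<mu> z) \<le> 1" for z by (simp add: \<mu>_def)
  have \<phi>_hol: "bounded_holomorphic (\<phi> n)" for n
  proof (rule bounded_holomorphicI)
    show "\<phi> n holomorphic_on \<Delta>" unfolding \<phi>_def using hol[of "Suc n"]
      by (auto simp: bounded_holomorphic_def intro!: holomorphic_intros)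
    show "cmod (\<phi> n z) \<le> exp (c (Suc n))" if "z \<in> \<Delta>" for z
      using Gc[OF that, of "Suc n"] complex_Re_le_cmod[of "G (Suc n) z"] by (simp add: \<phi>_def)
  qed
  have [measurable]: "\<phi> n \<in> borel_measurable ?M" for n
    by (rule bounded_holomorphic_measurable[OF \<phi>_hol])
  define L where "L n = {z\<in>\<Delta>. 3/2 < cmod (z + 1) \<and> cmod (z + 1) < 3/2 + \<delta> n}" for n
  define h where "h n z = cmod (\<phi> n z) - Re (\<mu> z * \<phi> n z)" for n z
  define b where "b n = 2 * (1/2) ^ n + exp (- real n)" for n
  have L: "L n \<in> sets ?M" "measure ?M (L n) \<le> 16 * \<delta> n" for n
    using measure_collar[OF \<delta>(1,3)[of n]] by (auto simp: L_def)
  have bound: "h n z \<le> b n + 2 * exp (c (Suc n)) * indicator (L (Suc n)) z" if z: "z \<in> \<Delta>" for n z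
  proof -
    have e: "cmod (\<phi> n z) \<le> exp (c (Suc n))"
      using Gc[OF z, of "Suc n"] complex_Re_le_cmod[of "G (Suc n) z"] by (simp add: \<phi>_def)
    have b: "b n \<ge> 0" "exp (- real n) \<le> b n" "2 * (1/2) ^ n \<le> b n" by (auto simp: b_def add_nonneg_nonneg)
    \<comment> \<open>Inside the circle \<open>\<phi> n\<close> itself is small, in the collar only
      a crude bound holds but the area is tiny, and beyond it the phase has nearly
      converged.\<close>
    consider "cmod (z + 1) \<le> 3/2" | "z \<in> L (Suc n)" | "3/2 + \<delta> (Suc n) \<le> cmod (z + 1)"
      using z by (force simp: L_def)
    then show ?thesis
    proof cases
      case 1
      then have "h n z \<le> exp (- real n)" using small[OF z, of n] by (simp add: h_def \<mu>_def \<phi>_def)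
      then show ?thesis using b(2) by (smt (verit) exp_gt_zero indicator_pos_le mult_nonneg_nonneg)
    next
      case 2
      have "cmod (\<mu> z * \<phi> n z) \<le> 1 * exp (c (Suc n))"
        unfolding norm_mult using \<mu>1 e by (intro mult_mono) auto
      then have "h n z \<le> 2 * exp (c (Suc n))"
        unfolding h_def using e abs_Re_le_cmod[of "\<mu> z * \<phi> n z"] by simp
      then show ?thesis using b(1) 2 by simp
    next
      case 3
      let ?g = "G (Suc n) z"
      \<comment> \<open>As \<open>\<mu>\<close> is the conjugate of the limiting phase, the defect
        is \<open>cmod (\<phi> n z)\<close> times 1 minus the cosine of the phase error. The factor
        \<open>exp (- c (Suc n))\<close> in that error cancels the growth of
        \<open>\<phi> n\<close>.\<close>
      have "\<mu> z = cis (- Im (\<Gamma> z))" using 3 \<delta>(1)[of "Suc n"] by (simp add: \<mu>_def)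
      moreover have "exp ?g = complex_of_real (exp (Re ?g)) * cis (Im ?g)"
        by (simp add: exp_eq_polar)
      ultimately have "\<mu> z * \<phi> n z = complex_of_real (exp (Re ?g)) * cis (Im ?g - Im (\<Gamma> z))"
        by (simp add: \<phi>_def cis_mult)
      then have "h n z = exp (Re ?g) * (1 - cos (Im ?g - Im (\<Gamma> z)))"
        by (simp add: h_def \<phi>_def algebra_simps)
      also have "\<dots> \<le> exp (c (Suc n)) * \<bar>Im ?g - Im (\<Gamma> z)\<bar>"
        using e by (intro mult_mono one_minus_cos_le_abs) (auto simp: \<phi>_def)
      also have "\<dots> \<le> exp (c (Suc n)) * (2 * exp (- c (Suc n)) * (1/2) ^ Suc n)"
        using conv(2)[OF z 3] abs_Im_le_cmod[of "?g - \<Gamma> z"] by (intro mult_left_mono) auto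
      also have "exp (c (Suc n)) * (2 * exp (- c (Suc n)) * (1/2) ^ Suc n) = (1/2) ^ n"
        by (simp add: exp_minus)
      also have "\<dots> \<le> 2 * (1/2) ^ n" by simp
      finally have "h n z \<le> b n" using b(3) by linarith
      then show ?thesis by (smt (verit) exp_gt_zero indicator_pos_le mult_nonneg_nonneg)
    qed
  qed
  have h0: "h n z \<ge> 0" for n z
  proof -
    have "Re (\<mu> z * \<phi> n z) \<le> cmod (\<mu> z) * cmod (\<phi> n z)"
      using complex_Re_le_cmod[of "\<mu> z * \<phi> n z"] by (simp add: norm_mult)
    also have "\<dots> \<le> 1 * cmod (\<phi> n z)" using \<mu>1 by (intro mult_right_mono) auto
    finally show ?thesis by (simp add: h_def)
  qed
  have int_le: "(LINT z|?M. h n z) \<le> b n * measure ?M \<Delta> + 2 * (1/2) ^ Suc n" for n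
  proof -
    interpret finite_measure ?M by (rule finite_measure_disc)
    have [measurable]: "L (Suc n) \<in> sets ?M" by (rule L)
    have int: "integrable ?M (indicator (L (Suc n)) :: complex \<Rightarrow> real)"
      by (rule integrable_const_bound[of _ 1]) auto
    have "(LINT z|?M. h n z) \<le> (LINT z|?M. b n + 2 * exp (c (Suc n)) * indicator (L (Suc n)) z)"
    proof (rule integral_mono_AE')
      show "integrable ?M (\<lambda>z. b n + 2 * exp (c (Suc n)) * indicator (L (Suc n)) z)"
        using int by auto
    qed (use bound order_trans[OF h0 bound] in \<open>auto intro!: AE_I2\<close>)
    also have "\<dots> = b n * measure ?M \<Delta> + 2 * exp (c (Suc n)) * measure ?M (L (Suc n))"
      using int L(1)[of "Suc n"] sets.sets_into_space[OF L(1)[of "Suc n"]]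
      by (simp add: Int_absorb2)
    \<comment> \<open>The collar area was chosen to absorb \<open>exp (c (Suc n))\<close>.\<close>
    also have "2 * exp (c (Suc n)) * measure ?M (L (Suc n)) \<le> 2 * exp (c (Suc n)) * (16 * \<delta> (Suc n))"
      using L(2) by (intro mult_left_mono) auto
    also have "\<dots> = 2 * (1/2) ^ Suc n" by (simp add: \<delta>_def exp_minus field_simps)
    finally show ?thesis by simp
  qed
  have bound_lim: "(\<lambda>n. b n * measure ?M \<Delta> + 2 * (1/2) ^ Suc n) \<longlonglongrightarrow> (2 * 0 + 0) * measure ?M \<Delta> + 2 * 0"
  proof -
    have e: "(\<lambda>n. exp (- real n)) \<longlonglongrightarrow> 0"
      by (rule filterlim_compose[OF exp_at_bot])
         (simp add: filterlim_uminus_at_bot filterlim_real_sequentially)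
    have p: "(\<lambda>n. (1/2::real) ^ n) \<longlonglongrightarrow> 0" by (rule LIMSEQ_power_zero) simp
    have p': "(\<lambda>n. (1/2::real) ^ Suc n) \<longlonglongrightarrow> 0" by (rule LIMSEQ_Suc[OF p])
    show ?thesis
      unfolding b_def by (rule tendsto_add tendsto_mult tendsto_const e p p')+
  qed
  have lim0: "(\<lambda>n. LINT z|?M. h n z) \<longlonglongrightarrow> 0"
  proof (rule tendsto_sandwich[where f = "\<lambda>_. 0" and h = "\<lambda>n. b n * measure ?M \<Delta> + 2 * (1/2) ^ Suc n"])
    show "(\<lambda>n. b n * measure ?M \<Delta> + 2 * (1/2) ^ Suc n) \<longlonglongrightarrow> 0"
      using bound_lim by simp
    show "\<forall>\<^sub>F n in sequentially. (LINT z|?M. h n z) \<le> b n * measure ?M \<Delta> + 2 * (1/2) ^ Suc n"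
      by (intro always_eventually allI int_le)
    show "\<forall>\<^sub>F n in sequentially. 0 \<le> (LINT z|?M. h n z)"
      by (intro always_eventually allI Bochner_Integration.integral_nonneg h0)
  qed (rule tendsto_const)
  have "(\<lambda>n. \<phi> n z) \<longlonglongrightarrow> exp (\<Gamma> z) \<and> exp (\<Gamma> z) \<noteq> 0 \<and> \<mu> z = cnj (sgn (exp (\<Gamma> z)))"
    if "z \<in> \<Delta>" "3/2 < cmod (z + 1)" for z
  proof -
    have "sgn (exp (\<Gamma> z)) = cis (Im (\<Gamma> z))"
      by (simp add: sgn_eq exp_eq_polar norm_mult)
    then show ?thesis
      using LIMSEQ_Suc[OF tends[OF that]] that
      by (auto simp: \<phi>_def \<mu>_def cis_cnj intro!: tendsto_exp)
  qed
  then show ?thesis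
    using \<mu>_meas bounded_holomorphic_QD[OF \<phi>_hol] lim0
    by (intro exI[of _ \<mu>] exI[of _ \<phi>] exI[of _ "\<lambda>z. exp (\<Gamma> z)"])
       (auto simp: h_def \<mu>_def)
qed

section \<open>Extremal Beltrami differentials\<close>

lemma AE_discI: "(\<And>z. z \<in> \<Delta> \<Longrightarrow> P z) \<Longrightarrow> AE z in lebesgue_on \<Delta>. P z"
  by (rule AE_I2) simp

lemma BelI:
  assumes "\<mu> \<in> borel_measurable (lebesgue_on \<Delta>)" "AE z in lebesgue_on \<Delta>. cmod (\<mu> z) \<le> C" "0 \<le> C"
  shows "\<mu> \<in> Bel" and "bel_norm \<mu> \<le> C"
proof -
  have le: "esssup (lebesgue_on \<Delta>) (\<lambda>z. ereal (cmod (\<mu> z))) \<le> ereal C"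
    using assms by (intro esssup_I) auto
  then show "\<mu> \<in> Bel" using assms(1) by (auto simp: Bel_def)
  show "bel_norm \<mu> \<le> C"
    using le assms(3) unfolding bel_norm_def
    by (cases "esssup (lebesgue_on \<Delta>) (\<lambda>z. ereal (cmod (\<mu> z)))") auto
qed

lemma Bel_measurable: "\<mu> \<in> Bel \<Longrightarrow> \<mu> \<in> borel_measurable (lebesgue_on \<Delta>)"
  by (simp add: Bel_def)

lemma AE_le_bel_norm:
  assumes "\<mu> \<in> Bel"
  shows "AE z in lebesgue_on \<Delta>. cmod (\<mu> z) \<le> bel_norm \<mu>"
proof -
  have "AE z in lebesgue_on \<Delta>. ereal (cmod (\<mu> z)) \<le> esssup (lebesgue_on \<Delta>) (\<lambda>z. ereal (cmod (\<mu> z)))"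
    by (rule esssup_AE)
  then show ?thesis
    using assms unfolding bel_norm_def Bel_def
    by (cases "esssup (lebesgue_on \<Delta>) (\<lambda>z. ereal (cmod (\<mu> z)))") (auto elim: eventually_mono)
qed

lemma Bel_mult_QD_integrable:
  assumes "\<mu> \<in> Bel" "\<phi> \<in> QD"
  shows "integrable (lebesgue_on \<Delta>) (\<lambda>z. \<mu> z * \<phi> z)"
proof (rule Bochner_Integration.integrable_bound)
  have i: "integrable (lebesgue_on \<Delta>) \<phi>" using assms by (simp add: QD_def)
  then show "integrable (lebesgue_on \<Delta>) (\<lambda>z. bel_norm \<mu> * cmod (\<phi> z))" by simp
  show "(\<lambda>z. \<mu> z * \<phi> z) \<in> borel_measurable (lebesgue_on \<Delta>)"
    using i Bel_measurable[OF assms(1)] by (intro borel_measurable_times) auto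
  show "AE z in lebesgue_on \<Delta>. cmod (\<mu> z * \<phi> z) \<le> norm (bel_norm \<mu> * cmod (\<phi> z))"
    using AE_le_bel_norm[OF assms(1)]
  proof (rule eventually_mono)
    fix z assume "cmod (\<mu> z) \<le> bel_norm \<mu>"
    moreover from this have "0 \<le> bel_norm \<mu>"
      using norm_ge_zero[of "\<mu> z"] by linarith
    ultimately show "cmod (\<mu> z * \<phi> z) \<le> norm (bel_norm \<mu> * cmod (\<phi> z))"
      by (simp add: norm_mult abs_mult mult_right_mono)
  qed
qed

lemma ZclassD:
  assumes "\<nu> \<in> Zclass \<mu>" "\<mu> \<in> Bel" "\<phi> \<in> QD"
  shows "(LINT z|lebesgue_on \<Delta>. \<nu> z * \<phi> z) = (LINT z|lebesgue_on \<Delta>. \<mu> z * \<phi> z)"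
proof -
  have "(LINT z|lebesgue_on \<Delta>. \<mu> z * \<phi> z - \<nu> z * \<phi> z) = 0"
    using assms by (simp add: Zclass_def inf_teich_equiv_def left_diff_distrib)
  then show ?thesis
    using Bel_mult_QD_integrable assms by (simp add: Zclass_def)
qed

lemma Zclass_refl: "\<mu> \<in> Bel \<Longrightarrow> \<mu> \<in> Zclass \<mu>"
  by (simp add: Zclass_def inf_teich_equiv_def)

text \<open>The product \<open>w * sgn a\<close> lies in the closed unit disc and has real part 1,
  so it is 1.\<close>

lemma eq_cnj_sgn_if_Re_mult_eq_cmod:
  assumes "cmod w \<le> 1" "Re (w * a) = cmod a" "a \<noteq> 0"
  shows "w = cnj (sgn a)"
proof -
  define u where "u = w * sgn a"
  have "cmod u \<le> 1" using assms by (simp add: u_def norm_mult norm_sgn)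
  moreover have "Re u = 1"
  proof -
    have "u = (w * a) / complex_of_real (cmod a)" by (simp add: u_def sgn_eq)
    then show ?thesis using assms by (simp add: Re_divide_of_real)
  qed
  ultimately have "u = 1"
    using cmod_power2[of u] power_le_one[of "cmod u" 2] by (auto simp: complex_eq_iff)
  moreover have "sgn a * cnj (sgn a) = 1"
    using assms(3) by (simp add: complex_norm_square[symmetric] norm_sgn)
  ultimately show ?thesis
    unfolding u_def by (metis mult.assoc mult.commute mult_1)
qed

text \<open>Reich's criterion for unique extremality, localised to a subset \<open>A\<close>.\<close>
lemma AE_eq_of_Hamilton_sequence:
  assumes \<mu>: "\<mu> \<in> Bel" and \<phi>: "\<And>n. \<phi> n \<in> QD"
    and lim: "(\<lambda>n. LINT z|lebesgue_on \<Delta>. cmod (\<phi> n z) - Re (\<mu> z * \<phi> n z)) \<longlonglongrightarrow> 0"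
    and A: "\<And>z. z \<in> A \<Longrightarrow> (\<lambda>n. \<phi> n z) \<longlonglongrightarrow> \<Phi> z"
           "\<And>z. z \<in> A \<Longrightarrow> \<Phi> z \<noteq> 0"
           "\<And>z. z \<in> A \<Longrightarrow> \<mu> z = cnj (sgn (\<Phi> z))"
    and \<nu>: "\<nu> \<in> Zclass \<mu>" "AE z in lebesgue_on \<Delta>. cmod (\<nu> z) \<le> 1"
  shows "AE z in lebesgue_on \<Delta>. z \<in> A \<longrightarrow> \<nu> z = \<mu> z"
proof -
  let ?M = "lebesgue_on \<Delta>"
  define h where "h n z = cmod (\<phi> n z) - Re (\<nu> z * \<phi> n z)" for n z
  have \<nu>B: "\<nu> \<in> Bel" using \<nu> by (simp add: Zclass_def)
  have i\<phi>: "integrable ?M (\<phi> n)" for n using \<phi> by (simp add: QD_def)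
  have i\<nu>: "integrable ?M (\<lambda>z. \<nu> z * \<phi> n z)" and i\<mu>: "integrable ?M (\<lambda>z. \<mu> z * \<phi> n z)" for n
    using Bel_mult_QD_integrable \<nu>B \<mu> \<phi> by auto
  have int: "integrable ?M (h n)" for n
    unfolding h_def using i\<phi> i\<nu> by (intro Bochner_Integration.integrable_diff integrable_norm integrable_Re)
  have split: "(LINT z|?M. cmod (\<phi> n z) - Re (\<kappa> z * \<phi> n z))
      = (LINT z|?M. cmod (\<phi> n z)) - Re (LINT z|?M. \<kappa> z * \<phi> n z)"
    if "integrable ?M (\<lambda>z. \<kappa> z * \<phi> n z)" for \<kappa> n
    by (subst Bochner_Integration.integral_diff[OF integrable_norm[OF i\<phi>] integrable_Re[OF that]])
       (simp only: integral_bounded_linear[OF bounded_linear_Re that])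
  \<comment> \<open>Equivalent differentials have the same integrals against
    \<open>\<phi> n\<close>, so \<open>\<nu>\<close> inherits the vanishing limit from
    \<open>\<mu>\<close>.\<close>
  have "(LINT z|?M. h n z) = (LINT z|?M. cmod (\<phi> n z) - Re (\<mu> z * \<phi> n z))" for n
    unfolding h_def split[OF i\<nu>] split[OF i\<mu>] ZclassD[OF \<nu>(1) \<mu> \<phi>] ..
  then have inth: "(\<lambda>n. LINT z|?M. h n z) \<longlonglongrightarrow> 0" using lim by simp
  have h0: "h n z \<ge> 0" if "cmod (\<nu> z) \<le> 1" for n z
  proof -
    have "Re (\<nu> z * \<phi> n z) \<le> cmod (\<nu> z) * cmod (\<phi> n z)"
      using complex_Re_le_cmod[of "\<nu> z * \<phi> n z"] by (simp add: norm_mult)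
    also have "\<dots> \<le> 1 * cmod (\<phi> n z)" using that by (intro mult_right_mono) auto
    finally show ?thesis by (simp add: h_def)
  qed
  \<comment> \<open>Passing to nonnegative integrals allows Fatou's lemma. A vanishing lower limit
    is enough, without subsequences, because \<open>h n z\<close> converges for \<open>z\<close> in
    \<open>A\<close>.\<close>
  have nn: "(\<integral>\<^sup>+z. ennreal (h n z) \<partial>?M) = ennreal (LINT z|?M. h n z)" for n
    using \<nu>(2) h0 by (intro nn_integral_eq_integral int) (auto elim: eventually_mono)
  have [measurable]: "h n \<in> borel_measurable ?M" for n using int by blast
  have "(\<integral>\<^sup>+z. liminf (\<lambda>n. ennreal (h n z)) \<partial>?M) \<le> liminf (\<lambda>n. \<integral>\<^sup>+z. ennreal (h n z) \<partial>?M)"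
    by (rule nn_integral_liminf) measurable
  also have "\<dots> = 0"
    unfolding nn using tendsto_ennrealI[OF inth] by (intro lim_imp_Liminf) auto
  finally have "AE z in ?M. liminf (\<lambda>n. ennreal (h n z)) = 0"
    by (subst nn_integral_0_iff_AE[symmetric]) auto
  with \<nu>(2) show ?thesis
  proof eventually_elim
    fix z assume z: "cmod (\<nu> z) \<le> 1" "liminf (\<lambda>n. ennreal (h n z)) = 0"
    show "z \<in> A \<longrightarrow> \<nu> z = \<mu> z"
    proof
      assume "z \<in> A"
      have "(\<lambda>n. h n z) \<longlonglongrightarrow> cmod (\<Phi> z) - Re (\<nu> z * \<Phi> z)"
        unfolding h_def using A(1)[OF \<open>z \<in> A\<close>] by (intro tendsto_intros)
      then have l: "(\<lambda>n. h n z) \<longlonglongrightarrow> cmod (\<Phi> z) - Re (\<nu> z * \<Phi> z)"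
        and "(\<lambda>n. ennreal (h n z)) \<longlonglongrightarrow> ennreal (cmod (\<Phi> z) - Re (\<nu> z * \<Phi> z))"
        by auto
      then have "ennreal (cmod (\<Phi> z) - Re (\<nu> z * \<Phi> z)) = 0"
        using z(2) lim_imp_Liminf[of sequentially "\<lambda>n. ennreal (h n z)"] by simp
      moreover have "cmod (\<Phi> z) - Re (\<nu> z * \<Phi> z) \<ge> 0"
        using l h0[OF z(1)] by (intro LIMSEQ_le_const) auto
      ultimately have "Re (\<nu> z * \<Phi> z) = cmod (\<Phi> z)" by simp
      then show "\<nu> z = \<mu> z"
        using eq_cnj_sgn_if_Re_mult_eq_cmod[OF z(1)] A(2,3)[OF \<open>z \<in> A\<close>] by simp
    qed
  qed
qed

lemma not_AE_notin_open:
  assumes "open G" "G \<noteq> {}" "G \<subseteq> \<Delta>"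
  shows "\<not> (AE z in lebesgue_on \<Delta>. z \<notin> G)"
proof
  assume "AE z in lebesgue_on \<Delta>. z \<notin> G"
  then have "AE z in lebesgue. z \<in> \<Delta> \<longrightarrow> z \<notin> G" by (simp add: AE_restrict_space_iff)
  then have "AE z in lborel. z \<in> \<Delta> \<longrightarrow> z \<notin> G" unfolding AE_completion_iff .
  then have "AE z in lborel. z \<notin> G" by (rule eventually_mono) (use assms(3) in blast)
  then have "G \<in> null_sets lborel"
    using assms(1) by (subst AE_iff_null_sets) (auto)
  then have "negligible G"
    using negligible_iff_null_sets null_sets_completionI by blast
  then show False using open_not_negligible assms by blast
qed

lemma class_norm_eqI:
  assumes "\<mu> \<in> C" "\<And>\<nu>. \<nu> \<in> C \<Longrightarrow> bel_norm \<mu> \<le> bel_norm \<nu>"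
  shows "class_norm C = bel_norm \<mu>"
  unfolding class_norm_def
proof (rule antisym)
  show "(INF \<nu>\<in>C. bel_norm \<nu>) \<le> bel_norm \<mu>"
    using assms by (intro cINF_lower) (auto intro!: bdd_belowI2)
  show "bel_norm \<mu> \<le> (INF \<nu>\<in>C. bel_norm \<nu>)"
    using assms by (intro cINF_greatest) auto
qed

section \<open>The minimal extremal and its pseudo non-decreasable perturbations\<close>

theorem corollary1:
  "\<exists>\<mu>\<in>Bel.
     (non_decreasable_in (Zclass \<mu>) \<mu> \<and> extremal_in (Zclass \<mu>) \<mu> \<and>
      (\<forall>\<nu>. non_decreasable_in (Zclass \<mu>) \<nu> \<and> extremal_in (Zclass \<mu>) \<nu> \<longrightarrow> (\<nu>, \<mu>) \<in> bel_eq)) \<and>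
     infinite ({\<nu>. pseudo_non_decreasable_in (Zclass \<mu>) \<nu> \<and> extremal_in (Zclass \<mu>) \<nu>} // bel_eq)"
proof -
  let ?M = "lebesgue_on \<Delta>"
  define A where "A = {z\<in>\<Delta>. 3/2 < cmod (z + 1)}"
  obtain \<mu> \<phi> \<Phi> where \<mu>m [measurable]: "\<mu> \<in> borel_measurable ?M"
    and \<mu>0: "\<And>z. cmod (z + 1) \<le> 3/2 \<Longrightarrow> \<mu> z = 0" and \<phi>: "\<And>n::nat. \<phi> n \<in> QD"
    and \<Phi>: "\<And>z. z \<in> A \<Longrightarrow> (\<lambda>n. \<phi> n z) \<longlonglongrightarrow> \<Phi> z" "\<And>z. z \<in> A \<Longrightarrow> \<Phi> z \<noteq> 0"
      "\<And>z. z \<in> A \<Longrightarrow> \<mu> z = cnj (sgn (\<Phi> z))"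
    and lim: "(\<lambda>n. LINT z|?M. cmod (\<phi> n z) - Re (\<mu> z * \<phi> n z)) \<longlonglongrightarrow> 0"
    using exists_phase_function unfolding A_def by (smt (verit) mem_Collect_eq)
  have \<mu>A: "cmod (\<mu> z) = 1" if "z \<in> A" for z
    using \<Phi>(2,3)[OF that] by (simp add: norm_sgn)
  have \<mu>nA: "\<mu> z = 0" if "z \<in> \<Delta>" "z \<notin> A" for z
    using that \<mu>0 by (auto simp: A_def)
  have \<mu>1: "cmod (\<mu> z) \<le> 1" if "z \<in> \<Delta>" for z
    using \<mu>A[of z] \<mu>nA[OF that] by (cases "z \<in> A") auto
  have \<mu>Bel: "\<mu> \<in> Bel" and \<mu>le: "bel_norm \<mu> \<le> 1"
    using BelI[OF \<mu>m AE_discI[OF \<mu>1]] by auto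
  let ?C = "Zclass \<mu>"
  have \<mu>C: "\<mu> \<in> ?C" by (rule Zclass_refl[OF \<mu>Bel])
  have unique: "AE z in ?M. z \<in> A \<longrightarrow> \<nu> z = \<mu> z" if "\<nu> \<in> ?C" "AE z in ?M. cmod (\<nu> z) \<le> 1" for \<nu>
    using AE_eq_of_Hamilton_sequence[where A = A, OF \<mu>Bel \<phi> lim \<Phi> that] .
  have opA: "open A" "A \<noteq> {}" "A \<subseteq> \<Delta>"
  proof -
    have "A = \<Delta> \<inter> {z. 3/2 < cmod (z + 1)}" by (auto simp: A_def)
    then show "open A" by (auto intro!: open_Int open_Collect_less continuous_intros)
    have "3/4 + 1 = (7/4 :: complex)" by simp
    then have "3/4 \<in> A"
      unfolding A_def mem_Collect_eq by (simp only: mem_ball_0 norm_divide norm_numeral) simp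
    then show "A \<noteq> {}" by blast
  qed (auto simp: A_def)
  \<comment> \<open>A member of norm below 1 would agree a.e. with \<open>\<mu>\<close> on the
    nonempty open set \<open>A\<close>, where \<open>\<mu>\<close> has modulus 1.\<close>
  have norm_ge: "1 \<le> bel_norm \<nu>" if \<nu>: "\<nu> \<in> ?C" for \<nu>
  proof (rule ccontr)
    assume less: "\<not> 1 \<le> bel_norm \<nu>"
    have le: "AE z in ?M. cmod (\<nu> z) \<le> bel_norm \<nu>"
      using \<nu> AE_le_bel_norm by (simp add: Zclass_def)
    then have "AE z in ?M. cmod (\<nu> z) \<le> 1" using less by (auto elim: eventually_mono)
    from unique[OF \<nu> this] le have "AE z in ?M. z \<notin> A"
      by eventually_elim (use less \<mu>A in auto)
    then show False using not_AE_notin_open opA by blast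
  qed
  have cn: "class_norm ?C = 1" and \<mu>n: "bel_norm \<mu> = 1"
    using class_norm_eqI[OF \<mu>C] norm_ge \<mu>le norm_ge[OF \<mu>C] by (auto intro: order_trans)
  have ext: "extremal_in ?C \<nu> \<longleftrightarrow> \<nu> \<in> ?C \<and> (AE z in ?M. cmod (\<nu> z) \<le> 1)" for \<nu>
  proof
    assume "extremal_in ?C \<nu>"
    then have "\<nu> \<in> ?C" "bel_norm \<nu> = 1" unfolding extremal_in_def cn by auto
    then show "\<nu> \<in> ?C \<and> (AE z in ?M. cmod (\<nu> z) \<le> 1)"
      using AE_le_bel_norm[of \<nu>] by (simp add: Zclass_def)
  next
    assume *: "\<nu> \<in> ?C \<and> (AE z in ?M. cmod (\<nu> z) \<le> 1)"
    then have "bel_norm \<nu> \<le> 1"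
      by (intro BelI) (auto simp: Zclass_def Bel_def)
    then show "extremal_in ?C \<nu>" using * norm_ge by (force simp: extremal_in_def cn)
  qed
  \<comment> \<open>An extremal equals \<open>\<mu>\<close> on \<open>A\<close>, and
    \<open>\<mu>\<close> is 0 elsewhere. Hence \<open>\<mu>\<close> competes against every extremal
    in the definition of non-decreasability, which gives both minimality and uniqueness.\<close>
  have \<mu>_min: "AE z in ?M. cmod (\<mu> z) \<le> cmod (\<nu> z)" if "extremal_in ?C \<nu>" for \<nu>
  proof -
    have "AE z in ?M. z \<in> A \<longrightarrow> \<nu> z = \<mu> z" using that unique by (simp add: ext)
    moreover have "AE z in ?M. z \<in> \<Delta>" by (rule AE_discI)
    ultimately show ?thesis by eventually_elim (use \<mu>nA in force)
  qed
  have nd: "non_decreasable_in ?C \<mu>"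
    unfolding non_decreasable_in_def
  proof (intro conjI ballI impI \<mu>C)
    fix \<nu> assume \<nu>: "\<nu> \<in> ?C" "AE z in ?M. cmod (\<nu> z) \<le> cmod (\<mu> z)"
    have D: "AE z in ?M. z \<in> \<Delta>" by (rule AE_discI)
    have "AE z in ?M. cmod (\<nu> z) \<le> 1"
      using \<nu>(2) D by eventually_elim (use \<mu>1 in force)
    from unique[OF \<nu>(1) this] \<nu>(2) D have "AE z in ?M. \<nu> z = \<mu> z"
      by eventually_elim (use \<mu>nA in force)
    then show "(\<nu>, \<mu>) \<in> bel_eq" using \<nu> \<mu>Bel by (simp add: bel_eq_def Zclass_def)
  qed
  have ex\<mu>: "extremal_in ?C \<mu>" using \<mu>C by (simp add: extremal_in_def cn \<mu>n)
  have un: "(\<nu>, \<mu>) \<in> bel_eq" if "non_decreasable_in ?C \<nu>" "extremal_in ?C \<nu>" for \<nu>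
  proof -
    have "(\<mu>, \<nu>) \<in> bel_eq"
      using that(1) \<mu>C \<mu>_min[OF that(2)] unfolding non_decreasable_in_def by blast
    then show ?thesis by (auto simp: bel_eq_def elim: eventually_mono)
  qed
  obtain S :: "complex set" where S: "closed S" "S \<subseteq> cball 0 (1/2)" "interior S = {}"
    "\<And>z w. cmod z = cmod w \<Longrightarrow> z \<in> S \<Longrightarrow> w \<in> S" "emeasure lborel S \<noteq> 0"
    using exists_fat_cantor_annuli by metis
  have SA: "z \<in> \<Delta>" "z \<notin> A" if "z \<in> S" for z
  proof -
    have "cmod z \<le> 1/2" using that S(2) by auto
    then show "z \<in> \<Delta>" "z \<notin> A" using norm_triangle_ineq[of z 1] by (auto simp: A_def)
  qed
  \<comment> \<open>The factor \<open>z\<close> removes the constant Taylor term, as orthogonality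
    requires; the distinct scalars make the perturbations pairwise different. On \<open>S\<close>,
    where \<open>\<mu>\<close> is 0, the modulus stays below 1.\<close>
  define \<eta> where "\<eta> n z = \<mu> z + (1 / of_nat (Suc n)) * (indicator S z * z)" for n :: nat and z
  have id [measurable]: "(\<lambda>z. z) \<in> borel_measurable ?M"
    by (intro measurable_restrict_space1 measurable_completion) auto
  have [measurable]: "indicator S \<in> borel_measurable ?M"
    using S(1) by (intro measurable_restrict_space1 borel_measurable_indicator) auto
  have \<eta>m: "\<eta> n \<in> borel_measurable ?M" for n unfolding \<eta>_def by measurable
  have \<eta>1: "cmod (\<eta> n z) \<le> 1" if "z \<in> \<Delta>" for n z
  proof (cases "z \<in> S")
    case True
    then have "cmod (\<eta> n z) = cmod z / real (Suc n)"
      using \<mu>nA SA[OF True] by (simp add: \<eta>_def norm_mult norm_divide del: of_nat_Suc)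
    also have "\<dots> \<le> 1 / 1" using that by (intro frac_le) auto
    finally show ?thesis by simp
  qed (use \<mu>1[OF that] in \<open>simp add: \<eta>_def\<close>)
  have \<eta>Bel: "\<eta> n \<in> Bel" for n
    using BelI(1)[OF \<eta>m AE_discI[OF \<eta>1]] by simp
  have \<eta>C: "\<eta> n \<in> ?C" for n
    unfolding Zclass_def inf_teich_equiv_def
  proof (intro CollectI conjI ballI \<eta>Bel)
    fix \<psi> assume "\<psi> \<in> QD"
    then have hol: "\<psi> holomorphic_on \<Delta>" by (simp add: QD_def)
    have "(LINT z|?M. indicator S z * z * \<psi> z) = 0"
      by (rule integral_rotation_invariant_holomorphic[OF borel_closed[OF S(1)] S(4) S(2) _ _ hol]) simp_all
    then have "(LINT z|?M. (- 1 / of_nat (Suc n)) * (indicator S z * z * \<psi> z)) = 0"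
      by simp
    then show "(LINT z|?M. (\<mu> z - \<eta> n z) * \<psi> z) = 0"
      by (simp add: \<eta>_def mult_ac)
  qed
  have \<eta>ext: "extremal_in ?C (\<eta> n)" for n
    unfolding ext using \<eta>C AE_discI[of "\<lambda>z. cmod (\<eta> n z) \<le> 1"] \<eta>1 by blast
  \<comment> \<open>The perturbations vanish at 0, so the origin is excepted; as a null set it does
    not affect the positive area of \<open>S\<close>.\<close>
  have notAE: "\<not> (AE z in ?M. z \<in> S \<longrightarrow> z = 0)"
  proof
    assume "AE z in ?M. z \<in> S \<longrightarrow> z = 0"
    then have "AE z in lebesgue. z \<in> \<Delta> \<longrightarrow> z \<in> S \<longrightarrow> z = 0"
      by (subst (asm) AE_restrict_space_iff) (rule fmeasurableD lmeasurable_ball | simp)+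
    then have "AE z in lborel. z \<in> \<Delta> \<longrightarrow> z \<in> S \<longrightarrow> z = 0" unfolding AE_completion_iff .
    moreover have "AE z in lborel. z \<noteq> (0::complex)" by (rule AE_lborel_singleton)
    ultimately have "AE z in lborel. z \<notin> S" by eventually_elim (use SA in blast)
    then have "S \<in> null_sets lborel" using S(1) by (subst AE_iff_null_sets) auto
    then show False using S(5) by auto
  qed
  have \<eta>_eq: "m = n" if "(\<eta> m, \<eta> n) \<in> bel_eq" for m n
  proof (rule ccontr)
    assume "m \<noteq> n"
    have "AE z in ?M. \<eta> m z = \<eta> n z" using that by (simp add: bel_eq_def)
    then have "AE z in ?M. z \<in> S \<longrightarrow> z = 0"
    proof eventually_elim
      fix z assume "\<eta> m z = \<eta> n z"
      then show "z \<in> S \<longrightarrow> z = 0"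
        using \<open>m \<noteq> n\<close> by (auto simp: \<eta>_def field_simps simp del: of_nat_Suc)
    qed
    with notAE show False by simp
  qed
  have \<eta>_nnd: "\<not> non_decreasable_in ?C (\<eta> n)" for n
  proof
    assume "non_decreasable_in ?C (\<eta> n)"
    from un[OF this \<eta>ext] have "AE z in ?M. \<eta> n z = \<mu> z" by (simp add: bel_eq_def)
    then have "AE z in ?M. z \<in> S \<longrightarrow> z = 0"
      by eventually_elim (auto simp: \<eta>_def simp del: of_nat_Suc)
    with notAE show False by simp
  qed
  have \<eta>_wnd: "\<not> strongly_decreasable_in ?C (\<eta> n)" for n
  proof
    assume "strongly_decreasable_in ?C (\<eta> n)"
    then obtain \<nu> G \<delta> where \<nu>: "\<nu> \<in> ?C" "AE z in ?M. cmod (\<nu> z) \<le> cmod (\<eta> n z)"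
      and G: "open G" "G \<noteq> {}" "G \<subseteq> \<Delta>" "\<delta> > 0" "AE z in lebesgue_on G. cmod (\<nu> z) \<le> cmod (\<eta> n z) - \<delta>"
      unfolding strongly_decreasable_in_def by blast
    have D: "AE z in ?M. z \<in> \<Delta>" by (rule AE_discI)
    have "AE z in ?M. cmod (\<nu> z) \<le> 1"
      using \<nu>(2) D by eventually_elim (use \<eta>1 in \<open>force intro: order_trans\<close>)
    note u = unique[OF \<nu>(1) this]
    have "AE z in lebesgue. z \<in> G \<longrightarrow> cmod (\<nu> z) \<le> cmod (\<eta> n z) - \<delta>"
      using G by (subst AE_restrict_space_iff[symmetric]) (auto simp: borel_open)
    then have "AE z in ?M. z \<in> G \<longrightarrow> cmod (\<nu> z) \<le> cmod (\<eta> n z) - \<delta>"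
      by (subst AE_restrict_space_iff) (auto elim: eventually_mono)
    \<comment> \<open>Off \<open>S\<close>, \<open>\<eta> n\<close> equals \<open>\<mu>\<close>: on
      \<open>A\<close> the competitor \<open>\<nu>\<close> has the same value, and elsewhere the
      value is 0, so a decrease by \<open>\<delta>\<close> is impossible. Thus \<open>G - S\<close>,
      open and nonempty, would be null.\<close>
    with u D have "AE z in ?M. z \<notin> G - S"
    proof eventually_elim
      fix z assume z: "z \<in> A \<longrightarrow> \<nu> z = \<mu> z" "z \<in> \<Delta>" "z \<in> G \<longrightarrow> cmod (\<nu> z) \<le> cmod (\<eta> n z) - \<delta>"
      show "z \<notin> G - S"
      proof
        assume "z \<in> G - S"
        then have "\<eta> n z = \<mu> z" "cmod (\<nu> z) \<le> cmod (\<eta> n z) - \<delta>" using z by (auto simp: \<eta>_def)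
        then show False using z(1) \<mu>nA[OF z(2)] G(4) norm_ge_zero[of "\<nu> z"] by (cases "z \<in> A") auto
      qed
    qed
    moreover have "G - S \<noteq> {}"
      using S(3) interior_maximal[of G S] G(1,2) by blast
    ultimately show False
      using not_AE_notin_open[of "G - S"] G(1,3) S(1) by (auto simp: open_Diff)
  qed
  have inf: "infinite ({\<nu>. pseudo_non_decreasable_in ?C \<nu> \<and> extremal_in ?C \<nu>} // bel_eq)"
  proof
    let ?Q = "{\<nu>. pseudo_non_decreasable_in ?C \<nu> \<and> extremal_in ?C \<nu>} // bel_eq"
    assume fin: "finite ?Q"
    have "\<eta> n \<in> {\<nu>. pseudo_non_decreasable_in ?C \<nu> \<and> extremal_in ?C \<nu>}" for n
      using \<eta>C \<eta>_wnd \<eta>_nnd \<eta>ext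
      by (simp add: pseudo_non_decreasable_in_def weakly_non_decreasable_in_def)
    then have sub: "range (\<lambda>n. bel_eq `` {\<eta> n}) \<subseteq> ?Q" by (auto intro: quotientI)
    have "inj (\<lambda>n. bel_eq `` {\<eta> n})"
    proof (rule injI)
      fix m n assume eq: "bel_eq `` {\<eta> m} = bel_eq `` {\<eta> n}"
      have "\<eta> n \<in> bel_eq `` {\<eta> n}" using \<eta>Bel by (simp add: bel_eq_def)
      then have "(\<eta> m, \<eta> n) \<in> bel_eq" using eq by blast
      then show "m = n" by (rule \<eta>_eq)
    qed
    then have "infinite (range (\<lambda>n. bel_eq `` {\<eta> n}))" by (rule range_inj_infinite)
    with fin sub show False using finite_subset by blast
  qed
  have "\<forall>\<nu>. non_decreasable_in ?C \<nu> \<and> extremal_in ?C \<nu> \<longrightarrow> (\<nu>, \<mu>) \<in> bel_eq"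
    using un by blast
  then show ?thesis
    by (intro bexI[of _ \<mu>] conjI nd ex\<mu> inf \<mu>Bel)
qed

end
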